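(* Under Assumption (D), the following holds on the event $\mathcal E$ of Assumption (C): (i) $\ell_n(\theta)=\tilde\ell_n(\theta)$ for all $\theta\in\tilde{\mathcal B}=\{\theta\in\mathbb R^p:\|\theta-\theta_{*,p}\|\le3\eta/8\}$; (ii) $\tilde\ell_n$ is $\tilde m$-strongly concave and has $\tilde\Lambda$-Lipschitz gradients on $\mathbb R^p$, with $\tilde\Lambda=7K$ and $\tilde m=c_{\min}np^{-\kappa_3}$. In particular, $\log\tilde\pi(\cdot\mid Z^{(n)})$ is $m$-strongly concave and has $\Lambda$-Lipschitz gradients with $\Lambda=7K+\Lambda_\pi$ and $m=c_{\min}np^{-\kappa_3}+m_\pi$.
   Context: General setting. Let $\Theta\subset\ell^2(\mathbb N)$ contain $\mathbb R^p$ (viewed as sequences vanishing after coordinate $p$); $\|\cdot\|$ is the $\ell^2$/Euclidean norm, $\|\cdot\|_{op}$ the operator norm, $\lambda_{\min}$ the smallest eigenvalue. For $\theta\in\Theta$, $\mathbb P_\theta$ is a law on a measurable space $\mathcal Z$ with density $p_\theta$ w.r.t. a measure $\nu$; data $Z^{(n)}=(Z_i)_{i=1}^n$ have law $\mathbb P^n_\theta=\otimes_{i=1}^n\mathbb P_\theta$. Let $\ell(\theta,z)=\log p_\theta(z)$, $\ell_n(\theta)=\sum_i\ell(\theta,Z_i)$. The prior $\Pi=\Pi_n$ is supported on $\mathbb R^p$ with Lebesgue density $\pi$; the posterior $\Pi(\cdot\mid Z^{(n)})$ has density proportional to $e^{\ell_n(\theta)}\pi(\theta)$. A function $f$ is $m$-strongly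 concave if $f(\theta')\le f(\theta)+(\theta'-\theta)^\top\nabla f(\theta)-\frac m2\|\theta-\theta'\|^2$ for all $\theta,\theta'$, and has $\Lambda$-Lipschitz gradients if $\|\nabla f(\theta)-\nabla f(\theta')\|\le\Lambda\|\theta-\theta'\|$. Assumption (A): the data have law $\mathbb P^n_{\theta_0}$ for a fixed $\theta_0\in\Theta$; there are $c_0>0$, $\theta_{*,p}\in\mathbb R^p$ with $\|\theta_{*,p}\|\le c_0$, and $0<\delta_n\to0$ such that for some $\beta\ge1$, any $c>0$ and any sufficiently large $L$ there are $C_1,\dots,C_4>0$ with $\mathbb P^n_{\theta_0}(\Pi(\{\theta:\|\theta-\theta_{*,p}\|^\beta>L\delta_n\}\mid Z^{(n)})\ge e^{-cn\delta_n^2})\le C_2e^{-C_1n\delta_n^2}$ and $\mathbb P^n_{\theta_0}(\int_{\|\theta-\theta_{*,p}\|\le\delta_n}e^{\ell_n(\theta)-\ell_n(\theta_0)}\pi(\theta)d\theta\le e^{-C_3n\delta_n^2})\le e^{-C_4n\delta_n^2}$. Assumption (B): $\log\pi$ is $m_\pi$-strongly concave with $\Lambda_\pi$-Lipschitz gradients, its maximiser $\theta_{\pi,\max}$ satisfies $\|\theta_{\pi,\max}\|\le c_0$, and the fourth moments of $\Pi$ are bounded uniformly in $n,p$. Assumption (C): there are $0<\eta\le1$, an event $\mathcal E$ with $\mathbb P^n_{\theta_0}(\mathcal E)\ge1-c'e^{-cn\delta_n^2}$ ($c,c'>0$), and $\mathcal B=\{\theta\in\mathbb R^p:\|\theta-\theta_{*,p}\|\le\eta\}$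 such that $\ell_n\in C^2(\mathcal B)$ a.s., and for some $c_{\max}\ge c_{\min}>0$, $\kappa_1,\kappa_2,\kappa_3\ge0$, on $\mathcal E$: $\|\nabla\ell_n(\theta_{*,p})\|\le c_{\max}n\delta_np^{\kappa_1}$, $\sup_{\theta\in\mathcal B}\|\nabla^2\ell_n(\theta)\|_{op}\le c_{\max}np^{\kappa_2}$, and $\inf_{\theta\in\mathcal B}\lambda_{\min}(-\nabla^2\ell_n(\theta))\ge c_{\min}np^{-\kappa_3}$. Surrogate: fix smooth $v:\mathbb R\to[0,1]$ with $v(t)=1$ for $t\le3/4$, $v(t)=0$ for $t>7/8$, and $\|v\|_{C^2}=\max_{j\le2}\sup|v^{(j)}|$; let $\varphi\ge0$ be smooth, even, supported in $[-1,1]$, $\int\varphi=1$, $\varphi_t(x)=t^{-1}\varphi(x/t)$; $\gamma_\eta(t)=0$ for $t<5\eta/8$, $(t-5\eta/8)^2$ otherwise; $v_\eta=\varphi_{\eta/8}*\gamma_\eta$. For $K>0$, $\theta_{\mathrm{init}}\in\mathbb R^p$: $\tilde\ell_n(\theta)=v(\|\theta-\theta_{\mathrm{init}}\|/\eta)(\ell_n(\theta)-\ell_n(\theta_{\mathrm{init}}))+\ell_n(\theta_{\mathrm{init}})-Kv_\eta(\|\theta-\theta_{\mathrm{init}}\|)$, and $\tilde\pi(\theta\mid Z^{(n)})\propto e^{\tilde\ell_n(\theta)}\pi(\theta)$. Assumption (D): (A), (B), (C) hold, $\|\theta_{\mathrm{init}}-\theta_{*,p}\|\le\eta/8$, and with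 $\tilde\delta_{n,p}=\max(\delta_n^{1/\beta},\delta_np^{\kappa_1+\kappa_3})$, for some $C>0$: $p\le Cn\delta_n^2$, $\eta\ge(\log n)\tilde\delta_{n,p}$, $K\ge60c_{\max}\|v\|_{C^2}n(1+p^{\kappa_2})$.
   Formalization: The sample size is assumed to satisfy n ≥ 2; for n = 1 the condition η ≥ (log n) δ̃ is vacuous and strong concavity can fail when δ_1 is large. *)

theory Defs
  imports "HOL-Analysis.Analysis"
begin

definition grad :: "('a::euclidean_space \<Rightarrow> real) \<Rightarrow> 'a \<Rightarrow> 'a" where
  "grad f x = (THE g. (f has_derivative (\<lambda>h. g \<bullet> h)) (at x))"

definition strongly_concave :: "real \<Rightarrow> ('a::euclidean_space \<Rightarrow> real) \<Rightarrow> bool" where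
  "strongly_concave m f \<longleftrightarrow> (\<forall>x. f differentiable (at x)) \<and>
     (\<forall>x y. f y \<le> f x + (y - x) \<bullet> grad f x - m / 2 * (norm (x - y))\<^sup>2)"

definition lipschitz_gradient :: "real \<Rightarrow> ('a::euclidean_space \<Rightarrow> real) \<Rightarrow> bool" where
  "lipschitz_gradient L f \<longleftrightarrow> (\<forall>x. f differentiable (at x)) \<and>
     (\<forall>x y. norm (grad f x - grad f y) \<le> L * norm (x - y))"

definition smooth_real :: "(real \<Rightarrow> real) \<Rightarrow> bool" where
  "smooth_real f \<longleftrightarrow> (\<forall>k x. ((deriv ^^ k) f) differentiable (at x))"

definition C2_norm :: "(real \<Rightarrow> real) \<Rightarrow> real" where
  "C2_norm v = Max ((\<lambda>j. SUP x. \<bar>(deriv ^^ j) v x\<bar>) ` {0..2::nat})"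

definition conv :: "(real \<Rightarrow> real) \<Rightarrow> (real \<Rightarrow> real) \<Rightarrow> real \<Rightarrow> real" where
  "conv f g x = (\<integral>y. f (x - y) * g y \<partial>lborel)"

definition moll :: "(real \<Rightarrow> real) \<Rightarrow> real \<Rightarrow> real \<Rightarrow> real" where
  "moll \<phi> t x = \<phi> (x / t) / t"

definition gamma_eta :: "real \<Rightarrow> real \<Rightarrow> real" where
  "gamma_eta \<eta> t = (if t < 5 * \<eta> / 8 then 0 else (t - 5 * \<eta> / 8)\<^sup>2)"

definition v_eta :: "(real \<Rightarrow> real) \<Rightarrow> real \<Rightarrow> real \<Rightarrow> real" where
  "v_eta \<phi> \<eta> = conv (moll \<phi> (\<eta> / 8)) (gamma_eta \<eta>)"

definition loglik :: "('a \<Rightarrow> 'z \<Rightarrow> real) \<Rightarrow> (nat \<Rightarrow> 'z) \<Rightarrow> nat \<Rightarrow> 'a \<Rightarrow> real" where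
  "loglik dens Z n \<theta> = (\<Sum>i<n. ln (dens \<theta> (Z i)))"

definition surrogate ::
  "(real \<Rightarrow> real) \<Rightarrow> (real \<Rightarrow> real) \<Rightarrow> real \<Rightarrow> real \<Rightarrow> 'a::euclidean_space \<Rightarrow> ('a \<Rightarrow> real) \<Rightarrow> 'a \<Rightarrow> real" where
  "surrogate v \<phi> \<eta> K \<theta>init l \<theta> =
     v (norm (\<theta> - \<theta>init) / \<eta>) * (l \<theta> - l \<theta>init) + l \<theta>init
     - K * v_eta \<phi> \<eta> (norm (\<theta> - \<theta>init))"

definition post_density :: "('a::euclidean_space \<Rightarrow> real) \<Rightarrow> ('a \<Rightarrow> real) \<Rightarrow> 'a \<Rightarrow> real" where
  "post_density l \<pi> \<theta> = exp (l \<theta>) * \<pi> \<theta> / (\<integral>t. exp (l t) * \<pi> t \<partial>lborel)"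

definition mat_eigenvalues :: "real^'n^'n \<Rightarrow> real set" where
  "mat_eigenvalues A = {\<mu>. \<exists>x. x \<noteq> 0 \<and> A *v x = \<mu> *\<^sub>R x}"

definition lambda_min :: "real^'n^'n \<Rightarrow> real" where
  "lambda_min A = Inf (mat_eigenvalues A)"

definition op_norm :: "real^'n^'m \<Rightarrow> real" where
  "op_norm A = onorm (\<lambda>x. A *v x)"

end

theory Submission
  imports Defs
begin

text \<open>Put \<open>r = norm (\<theta> - \<theta>init)\<close> and call \<open>K * v_eta r\<close> the penalty. For \<open>r \<le> 3 \<eta> / 4\<close> the cutoff is 1 and the penalty is convex,
  so the Hessian of the surrogate lies below that of the log-likelihood. For larger \<open>r\<close> both Hessian
  eigenvalues \<open>v_eta'' r\<close> and \<open>v_eta' r / r\<close> of \<open>v_eta r\<close> are at least \<open>1/3\<close>, and \<open>K / 3\<close>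
  exceeds the operator norm of the Hessian of the cut-off log-likelihood, which is bounded by means of
  the gradient bound at \<open>\<theta>star\<close> and the Hessian bound on the ball. Everywhere the penalty has
  bounded Hessian, which yields the Lipschitz constant. The surrogate is differentiable twice in all of
  space, so both conclusions follow by integrating along line segments.\<close>

section \<open>Gradients and Hessians\<close>

text \<open>The radii are tuned so that the pieces do not interfere. Mollifying at scale \<eta>/8
  spreads the kink of \<open>gamma_eta\<close> at 5\<eta>/8 over [\<eta>/2, 3\<eta>/4], and the
  cutoff moves only on [3\<eta>/4, 7\<eta>/8]; so the penalty has full curvature before the cutoff
  starts to fall. The offset \<eta>/8 of \<open>\<theta>init\<close> still leaves a ball of radius
  3\<eta>/8 around \<open>\<theta>star\<close> untouched, and keeps the support of the cutoff inside
  the ball where \<open>l\<close> is controlled. Budget for \<open>K\<close>: with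
  \<open>N = C2_norm v\<close>, the cut-off log-likelihood has Hessian at most
  \<open>11 * a * N * (1 + P)\<close>, and \<open>m\<close> is at most
  \<open>a * N * (1 + P)\<close>. Concavity therefore asks for 3 * 12 = 36 such units and 60
  suffice; for the Lipschitz constant the penalty contributes \<open>6 * K\<close> and the rest fits
  into one more \<open>K\<close>. One gap has to be closed: \<open>lambda_min\<close> is an infimum
  of real eigenvalues and controls the quadratic form only for a symmetric matrix, while
  \<open>hessl\<close> is given merely as the derivative of \<open>gradl\<close>. Symmetry has to be
  derived.\<close>

lemma grad_eqI:
  assumes "(f has_derivative (\<lambda>h. g \<bullet> h)) (at x)"
  shows "grad f x = g"
  unfolding grad_def
proof (rule the_equality)
  fix g' assume "(f has_derivative (\<lambda>h. g' \<bullet> h)) (at x)"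
  then have "(\<lambda>h. g' \<bullet> h) = (\<lambda>h. g \<bullet> h)"
    using assms by (rule has_derivative_unique)
  then show "g' = g"
    by (metis vector_eq_rdot)
qed fact

text \<open>The vector \<open>adjoint D 1\<close> is the Riesz representative of the functional
  \<open>D\<close>, so the description in \<open>grad\<close> is inhabited at every point of
  differentiability.\<close>

lemma has_derivative_grad:
  fixes f :: "'a::euclidean_space \<Rightarrow> real"
  assumes "f differentiable (at x)"
  shows "(f has_derivative (\<lambda>h. grad f x \<bullet> h)) (at x)"
proof -
  from assms obtain D where D: "(f has_derivative D) (at x)"
    unfolding differentiable_def by blast
  have lin: "linear D" using D by (rule has_derivative_linear)
  have "D h = adjoint D 1 \<bullet> h" for h
    using adjoint_works[OF lin, of h 1] by (simp add: inner_commute)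
  then have "(f has_derivative (\<lambda>h. adjoint D 1 \<bullet> h)) (at x)"
    using D by (metis (no_types, lifting) ext)
  with grad_eqI[OF this] show ?thesis by simp
qed

lemma DERIV_along_line:
  assumes "(f has_derivative (\<lambda>h. g \<bullet> h)) (at (x + t *\<^sub>R u))"
  shows "((\<lambda>s. f (x + s *\<^sub>R u)) has_real_derivative g \<bullet> u) (at t)"
proof -
  have "((\<lambda>s. x + s *\<^sub>R u) has_derivative (\<lambda>s. s *\<^sub>R u)) (at t)"
    by (auto intro!: derivative_eq_intros)
  from has_derivative_compose[OF this assms]
  show ?thesis by (simp add: has_field_derivative_def mult.commute[of _ "g \<bullet> u"])
qed

lemma DERIV_grad_along_line:
  fixes G :: "'a::euclidean_space \<Rightarrow> 'a"
  assumes "(G has_derivative H) (at (x + t *\<^sub>R u))"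
  shows "((\<lambda>s. G (x + s *\<^sub>R u) \<bullet> d) has_real_derivative H u \<bullet> d) (at t)"
proof -
  have "((\<lambda>s. x + s *\<^sub>R u) has_derivative (\<lambda>s. s *\<^sub>R u)) (at t)"
    by (auto intro!: derivative_eq_intros)
  from has_derivative_inner_left[OF has_derivative_compose[OF this assms], of d]
  have "((\<lambda>s. G (x + s *\<^sub>R u) \<bullet> d) has_derivative (\<lambda>s. H (s *\<^sub>R u) \<bullet> d)) (at t)" .
  moreover have "H (s *\<^sub>R u) \<bullet> d = (H u \<bullet> d) * s" for s
    using linear_scale[OF has_derivative_linear[OF assms]] by simp
  ultimately show ?thesis by (simp add: has_field_derivative_def)
qed

text \<open>Adding the quadratic \<open>m / 2 * (norm d)\<^sup>2 * t\<^sup>2\<close> along the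
  segment reduces the claim to a nonincreasing \<open>F'\<close>. The mean value theorem takes the
  place of an integral, so it is enough that the Hessian exists at each point.\<close>

lemma strongly_concaveI:
  fixes f :: "'a::euclidean_space \<Rightarrow> real"
  assumes f: "\<And>x. (f has_derivative (\<lambda>h. G x \<bullet> h)) (at x)"
    and G: "\<And>x. (G has_derivative H x) (at x)"
    and H: "\<And>x h. h \<bullet> H x h \<le> - m * (norm h)\<^sup>2"
  shows "strongly_concave m f"
  unfolding strongly_concave_def
proof safe
  fix x show "f differentiable (at x)"
    using f differentiable_def by blast
next
  fix x y :: 'a
  define d where "d = y - x"
  define F where "F t = f (x + t *\<^sub>R d) + m / 2 * (norm d)\<^sup>2 * t\<^sup>2" for t
  define F' where "F' t = G (x + t *\<^sub>R d) \<bullet> d + m * (norm d)\<^sup>2 * t" for t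
  have F: "(F has_real_derivative F' t) (at t)" for t
    unfolding F_def F'_def
    by (rule derivative_eq_intros DERIV_along_line[OF f] | simp)+
  have F': "(F' has_real_derivative (H (x + t *\<^sub>R d) d \<bullet> d + m * (norm d)\<^sup>2)) (at t)" for t
    unfolding F'_def
    by (rule derivative_eq_intros DERIV_grad_along_line[OF G] | simp)+
  have dec: "F' b \<le> F' a" if "a \<le> b" for a b
  proof (rule DERIV_nonpos_imp_nonincreasing[OF that])
    fix t
    show "\<exists>D. DERIV F' t :> D \<and> D \<le> 0"
      using F'[of t] H[of d "x + t *\<^sub>R d"] by (force simp: inner_commute)
  qed
  obtain z where z: "0 < z" "z < 1" "F 1 - F 0 = (1 - 0) * F' z"
    using MVT2[of 0 1 F F'] F by auto
  have "F 1 - F 0 \<le> F' 0" using z dec[of 0 z] by simp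
  then show "f y \<le> f x + (y - x) \<bullet> grad f x - m / 2 * (norm (x - y))\<^sup>2"
    by (simp add: F_def F'_def d_def grad_eqI[OF f] inner_commute norm_minus_commute)
qed

lemma lipschitz_gradientI:
  fixes f :: "'a::euclidean_space \<Rightarrow> real"
  assumes f: "\<And>x. (f has_derivative (\<lambda>h. G x \<bullet> h)) (at x)"
    and G: "\<And>x. (G has_derivative H x) (at x)"
    and H: "\<And>x h. norm (H x h) \<le> L * norm h"
  shows "lipschitz_gradient L f"
  unfolding lipschitz_gradient_def grad_eqI[OF f]
proof safe
  fix x show "f differentiable (at x)"
    using f differentiable_def by blast
next
  fix x y show "norm (G x - G y) \<le> L * norm (x - y)"
    by (rule differentiable_bound[of UNIV G H]) (use G H in \<open>auto intro!: onorm_le\<close>)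
qed

text \<open>A function dominated by one that is o(|y - x|) is o(|y - x|) itself. This handles a
  product of a flat cutoff and a factor that is bounded where the cutoff lives but need not be
  differentiable at \<open>x\<close>.\<close>

lemma has_derivative_zero_dominated:
  fixes f :: "'a::real_normed_vector \<Rightarrow> 'b::real_normed_vector"
    and k :: "'a \<Rightarrow> 'c::real_normed_vector"
  assumes f: "(f has_derivative (\<lambda>h. 0)) (at x)" and "f x = 0"
    and k: "\<And>y. norm (k y) \<le> M * norm (f y)"
  shows "(k has_derivative (\<lambda>h. 0)) (at x)"
proof -
  have "k x = 0" using k[of x] \<open>f x = 0\<close> by simp
  have "((\<lambda>y. norm (f y) / norm (y - x)) \<longlongrightarrow> 0) (at x)"
    using f \<open>f x = 0\<close> by (simp add: has_derivative_iff_norm)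
  then have "((\<lambda>y. M * (norm (f y) / norm (y - x))) \<longlongrightarrow> 0) (at x)"
    using tendsto_mult_right_zero by blast
  then have "((\<lambda>y. norm (k y) / norm (y - x)) \<longlongrightarrow> 0) (at x)"
    by (rule Lim_null_comparison[rotated])
      (auto intro!: always_eventually simp: divide_right_mono k)
  then show ?thesis
    using \<open>k x = 0\<close> by (simp add: has_derivative_iff_norm)
qed

text \<open>The mean value theorem is applied once, in direction \<open>u\<close>, to the increment
  of \<open>f\<close> in direction \<open>w\<close>. The resulting difference of two gradients is
  expanded at \<open>x\<close>, where alone \<open>G\<close> has to be differentiable.\<close>

lemma second_difference_approx:
  fixes f :: "'a::euclidean_space \<Rightarrow> real"
  assumes "open U" "x \<in> U"
    and f: "\<And>y. y \<in> U \<Longrightarrow> (f has_derivative (\<lambda>h. G y \<bullet> h)) (at y)"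
    and G: "(G has_derivative H) (at x)" and "e > 0"
  shows "\<exists>d>0. \<forall>t. 0 < t \<and> t < d \<longrightarrow>
    \<bar>f (x + t *\<^sub>R u + t *\<^sub>R w) - f (x + t *\<^sub>R u) - f (x + t *\<^sub>R w) + f x - t\<^sup>2 * (u \<bullet> H w)\<bar> \<le> e * t\<^sup>2"
proof -
  define c where "c = norm u + norm w + 1"
  have c: "c > 0" "norm u \<le> c" "norm w \<le> c" by (auto simp: c_def add_nonneg_pos)
  \<comment> \<open>Two remainders, each at most \<open>e' * (t * c)\<close>, are paired with
    \<open>u\<close> of norm at most \<open>c\<close>; this choice makes the total
    \<open>e * t\<close>.\<close>
  define e' where "e' = e / (2 * c * c)"
  have "e' > 0" using \<open>e > 0\<close> c by (simp add: e'_def)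
  obtain d1 where "d1 > 0" and d1: "ball x d1 \<subseteq> U"
    using assms(1,2) open_contains_ball by blast
  obtain d2 where "d2 > 0" and d2:
    "\<And>y. norm (y - x) < d2 \<Longrightarrow> norm (G y - G x - H (y - x)) \<le> e' * norm (y - x)"
    using G \<open>e' > 0\<close> unfolding has_derivative_at_alt by blast
  define d where "d = min d1 d2 / c"
  have "d > 0" using \<open>d1 > 0\<close> \<open>d2 > 0\<close> c by (simp add: d_def)
  moreover have "\<bar>f (x + t *\<^sub>R u + t *\<^sub>R w) - f (x + t *\<^sub>R u) - f (x + t *\<^sub>R w) + f x - t\<^sup>2 * (u \<bullet> H w)\<bar> \<le> e * t\<^sup>2"
    if t: "0 < t" "t < d" for t
  proof -
    have tc: "t * c < d1" "t * c < d2"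
      using t c by (simp_all add: d_def field_simps)
    have nrm: "norm (s *\<^sub>R u + r *\<^sub>R w) \<le> t * c" if "0 \<le> s" "s \<le> t" "0 \<le> r" "r \<le> t" for s r
    proof -
      have "norm (s *\<^sub>R u + r *\<^sub>R w) \<le> s * norm u + r * norm w"
        using that norm_triangle_ineq[of "s *\<^sub>R u" "r *\<^sub>R w"] by simp
      also have "\<dots> \<le> t * norm u + t * norm w"
        using that by (intro add_mono mult_right_mono) auto
      also have "\<dots> \<le> t * c" using t by (simp add: c_def algebra_simps)
      finally show ?thesis .
    qed
    have inU: "x + s *\<^sub>R u + r *\<^sub>R w \<in> U" if "0 \<le> s" "s \<le> t" "0 \<le> r" "r \<le> t" for s r
    proof -
      have "dist x (x + s *\<^sub>R u + r *\<^sub>R w) = norm (s *\<^sub>R u + r *\<^sub>R w)"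
        by (metis add.assoc add_diff_cancel_left' dist_commute dist_norm)
      then show ?thesis using nrm[OF that] tc d1 by auto
    qed
    define F where "F s = f (x + t *\<^sub>R w + s *\<^sub>R u) - f (x + s *\<^sub>R u)" for s
    define F' where "F' s = G (x + t *\<^sub>R w + s *\<^sub>R u) \<bullet> u - G (x + s *\<^sub>R u) \<bullet> u" for s
    have "(F has_real_derivative F' s) (at s)" if "0 \<le> s" "s \<le> t" for s
      unfolding F_def F'_def
    proof (intro DERIV_diff DERIV_along_line f)
      show "x + t *\<^sub>R w + s *\<^sub>R u \<in> U"
        using inU[of s t] that t by (simp add: algebra_simps)
      show "x + s *\<^sub>R u \<in> U" using inU[of s 0] that t by simp
    qed
    then obtain s where s: "0 < s" "s < t" "F t - F 0 = t * F' s"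
      using MVT2[of 0 t F F'] t by auto
    have lin: "linear H" using G by (rule has_derivative_linear)
    define r where "r y = G y - G x - H (y - x)" for y
    have r: "norm (r (x + s *\<^sub>R u + q *\<^sub>R w)) \<le> e' * (t * c)" if "0 \<le> q" "q \<le> t" for q
    proof -
      have le: "norm (s *\<^sub>R u + q *\<^sub>R w) \<le> t * c" using nrm[of s q] s that by simp
      then have "norm (r (x + s *\<^sub>R u + q *\<^sub>R w)) \<le> e' * norm (s *\<^sub>R u + q *\<^sub>R w)"
        using d2[of "x + s *\<^sub>R u + q *\<^sub>R w"] tc by (simp add: r_def add.assoc)
      also have "\<dots> \<le> e' * (t * c)" using le \<open>e' > 0\<close> by simp
      finally show ?thesis .
    qed
    have "F' s = (G (x + s *\<^sub>R u + t *\<^sub>R w) - G (x + s *\<^sub>R u)) \<bullet> u"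
      by (simp add: F'_def inner_diff_left algebra_simps)
    also have "G (x + s *\<^sub>R u + t *\<^sub>R w) - G (x + s *\<^sub>R u)
        = r (x + s *\<^sub>R u + t *\<^sub>R w) - r (x + s *\<^sub>R u + 0 *\<^sub>R w) + t *\<^sub>R H w"
      by (simp add: r_def add.assoc linear_add[OF lin] linear_scale[OF lin])
    finally have "F' s - t * (u \<bullet> H w)
        = (r (x + s *\<^sub>R u + t *\<^sub>R w) - r (x + s *\<^sub>R u + 0 *\<^sub>R w)) \<bullet> u"
      by (simp add: inner_add_left inner_commute[of "H w"])
    also have "\<bar>\<dots>\<bar> \<le> norm (r (x + s *\<^sub>R u + t *\<^sub>R w) - r (x + s *\<^sub>R u + 0 *\<^sub>R w)) * norm u"
      by (rule Cauchy_Schwarz_ineq2)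
    also have "\<dots> \<le> (e' * (t * c) + e' * (t * c)) * c"
    proof (rule mult_mono)
      show "norm (r (x + s *\<^sub>R u + t *\<^sub>R w) - r (x + s *\<^sub>R u + 0 *\<^sub>R w)) \<le> e' * (t * c) + e' * (t * c)"
        using t by (intro order_trans[OF norm_triangle_ineq4] add_mono r) auto
    qed (use t c \<open>e' > 0\<close> in auto)
    also have "\<dots> = e * t" using c by (simp add: e'_def field_simps)
    finally have "\<bar>F' s - t * (u \<bullet> H w)\<bar> \<le> e * t" .
    then have "t * \<bar>F' s - t * (u \<bullet> H w)\<bar> \<le> t * (e * t)" using t by simp
    moreover have "t * \<bar>F' s - t * (u \<bullet> H w)\<bar> = \<bar>F t - F 0 - t\<^sup>2 * (u \<bullet> H w)\<bar>"
    proof -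
      have "F t - F 0 - t\<^sup>2 * (u \<bullet> H w) = t * (F' s - t * (u \<bullet> H w))"
        by (simp add: s(3) power2_eq_square algebra_simps)
      then show ?thesis using t by (simp add: abs_mult)
    qed
    moreover have "F t - F 0 = f (x + t *\<^sub>R u + t *\<^sub>R w) - f (x + t *\<^sub>R u) - f (x + t *\<^sub>R w) + f x"
      by (simp add: F_def algebra_simps)
    ultimately show ?thesis by (simp add: power2_eq_square algebra_simps)
  qed
  ultimately show ?thesis by blast
qed

text \<open>The second difference does not change when \<open>u\<close> and \<open>w\<close> are
  swapped, so its two approximations must agree.\<close>

lemma symmetric_second_derivative:
  fixes f :: "'a::euclidean_space \<Rightarrow> real"
  assumes "open U" "x \<in> U"
    and "\<And>y. y \<in> U \<Longrightarrow> (f has_derivative (\<lambda>h. G y \<bullet> h)) (at y)"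
    and "(G has_derivative H) (at x)"
  shows "u \<bullet> H w = w \<bullet> H u"
proof -
  have "\<bar>u \<bullet> H w - w \<bullet> H u\<bar> \<le> 0 + e" if "e > 0" for e
  proof -
    have e2: "e / 2 > 0" using that by simp
    obtain d1 where d1: "d1 > 0" "\<And>t. 0 < t \<Longrightarrow> t < d1 \<Longrightarrow>
      \<bar>f (x + t *\<^sub>R u + t *\<^sub>R w) - f (x + t *\<^sub>R u) - f (x + t *\<^sub>R w) + f x - t\<^sup>2 * (u \<bullet> H w)\<bar> \<le> e/2 * t\<^sup>2"
      using second_difference_approx[OF assms e2, of u w] by blast
    obtain d2 where d2: "d2 > 0" "\<And>t. 0 < t \<Longrightarrow> t < d2 \<Longrightarrow>
      \<bar>f (x + t *\<^sub>R w + t *\<^sub>R u) - f (x + t *\<^sub>R w) - f (x + t *\<^sub>R u) + f x - t\<^sup>2 * (w \<bullet> H u)\<bar> \<le> e/2 * t\<^sup>2"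
      using second_difference_approx[OF assms e2, of w u] by blast
    define t where "t = min d1 d2 / 2"
    have t: "0 < t" "t < d1" "t < d2" using d1 d2 by (auto simp: t_def)
    have eq: "x + t *\<^sub>R w + t *\<^sub>R u = x + t *\<^sub>R u + t *\<^sub>R w" by simp
    have "\<bar>t\<^sup>2 * (u \<bullet> H w) - t\<^sup>2 * (w \<bullet> H u)\<bar> \<le> e * t\<^sup>2"
      using d1(2)[OF t(1,2)] d2(2)[OF t(1,3)] unfolding eq by linarith
    moreover have "\<bar>t\<^sup>2 * (u \<bullet> H w) - t\<^sup>2 * (w \<bullet> H u)\<bar> = \<bar>u \<bullet> H w - w \<bullet> H u\<bar> * t\<^sup>2"
      by (simp add: abs_mult flip: right_diff_distrib)
    ultimately show ?thesis using t by simp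
  qed
  then have "\<bar>u \<bullet> H w - w \<bullet> H u\<bar> \<le> 0" by (rule field_le_epsilon)
  then show ?thesis by simp
qed

text \<open>A minimiser \<open>x0\<close> of the form on the unit sphere is an eigenvector, hence
  its value \<mu> bounds the infimum from above, and by homogeneity \<mu> bounds the form from below
  everywhere.\<close>

lemma lambda_min_le_quadratic_form:
  fixes A :: "real^'n^'n"
  assumes sym: "\<And>x y. x \<bullet> (A *v y) = y \<bullet> (A *v x)"
  shows "lambda_min A * (norm x)\<^sup>2 \<le> x \<bullet> (A *v x)"
proof -
  have "continuous_on (sphere 0 1) (\<lambda>x::real^'n. x \<bullet> (A *v x))"
    by (intro continuous_intros matrix_vector_mult_linear_continuous_on)
  moreover have "sphere (0::real^'n) 1 \<noteq> {}" by simp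
  ultimately obtain x0 :: "real^'n" where x0: "x0 \<in> sphere 0 1"
    and min: "\<And>y. y \<in> sphere 0 1 \<Longrightarrow> x0 \<bullet> (A *v x0) \<le> y \<bullet> (A *v y)"
    using continuous_attains_inf[OF compact_sphere] by blast
  define \<mu> where "\<mu> = x0 \<bullet> (A *v x0)"
  have quad: "\<mu> * (norm y)\<^sup>2 \<le> y \<bullet> (A *v y)" for y
  proof (cases "y = 0")
    case False
    define z where "z = (1 / norm y) *\<^sub>R y"
    have "y = norm y *\<^sub>R z" using False by (simp add: z_def)
    have "z \<in> sphere 0 1" using False by (simp add: z_def)
    then have "(norm y)\<^sup>2 * \<mu> \<le> (norm y)\<^sup>2 * (z \<bullet> (A *v z))"
      unfolding \<mu>_def by (intro mult_left_mono min) auto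
    also have "\<dots> = (norm y *\<^sub>R z) \<bullet> (A *v (norm y *\<^sub>R z))"
      by (simp add: matrix_vector_mult_scaleR power2_eq_square)
    also have "\<dots> = y \<bullet> (A *v y)"
      by (simp flip: \<open>y = norm y *\<^sub>R z\<close>)
    finally show ?thesis by (simp add: mult.commute)
  qed simp
  have x0n: "norm x0 = 1" using x0 by simp
  define r where "r = A *v x0 - \<mu> *\<^sub>R x0"
  \<comment> \<open>First variation of the minimum in the direction of the residual
    \<open>r\<close>, which is orthogonal to \<open>x0\<close>. The linear term forces
    \<open>r = 0\<close>.\<close>
  have ge: "2 * t * (r \<bullet> r) + t\<^sup>2 * (r \<bullet> (A *v r) - \<mu> * (r \<bullet> r)) \<ge> 0" for t
  proof -
    have xx: "x0 \<bullet> x0 = 1" using x0n by (simp add: norm_eq_1)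
    have xr: "x0 \<bullet> r = 0" by (simp add: r_def inner_diff_right xx \<mu>_def)
    have "r \<bullet> (A *v x0) = r \<bullet> r"
      using xr by (simp add: r_def inner_diff_right inner_commute)
    moreover have "(x0 + t *\<^sub>R r) \<bullet> (A *v (x0 + t *\<^sub>R r))
        = \<mu> + 2 * t * (r \<bullet> (A *v x0)) + t\<^sup>2 * (r \<bullet> (A *v r))"
      using sym[of x0 r] by (simp add: \<mu>_def matrix_vector_right_distrib matrix_vector_mult_scaleR
          inner_add_left inner_add_right power2_eq_square algebra_simps)
    moreover have "(norm (x0 + t *\<^sub>R r))\<^sup>2 = 1 + t\<^sup>2 * (r \<bullet> r)"
      using xr xx by (simp add: power2_norm_eq_inner inner_add_left inner_add_right
          inner_commute power2_eq_square[of t])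
    ultimately show ?thesis
      using quad[of "x0 + t *\<^sub>R r"] by (simp add: algebra_simps)
  qed
  have False if pos: "r \<bullet> r > 0"
  proof -
    define a where "a = r \<bullet> r"
    define b where "b = \<bar>r \<bullet> (A *v r) - \<mu> * (r \<bullet> r)\<bar> + 1"
    have b: "b > 0" by (simp add: b_def)
    \<comment> \<open>With \<open>t = - (a / b)\<close> the linear term contributes
      \<open>- 2 * a\<^sup>2 / b\<close> and the quadratic one at most
      \<open>a\<^sup>2 / b\<close>.\<close>
    have "0 \<le> 2 * (- (a / b)) * a + (a / b)\<^sup>2 * (r \<bullet> (A *v r) - \<mu> * (r \<bullet> r))"
      using ge[of "- (a / b)"] by (simp add: a_def)
    also have "\<dots> \<le> 2 * (- (a / b)) * a + (a / b)\<^sup>2 * b"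
      by (intro add_left_mono mult_left_mono) (auto simp: b_def)
    also have "\<dots> = - (a\<^sup>2 / b)" using b by (simp add: power2_eq_square field_simps)
    also have "\<dots> < 0" using b pos by (simp add: a_def)
    finally show False by simp
  qed
  then have "r \<bullet> r = 0" by (metis inner_ge_zero less_le)
  then have "A *v x0 = \<mu> *\<^sub>R x0" by (simp add: r_def)
  moreover have "x0 \<noteq> 0" using x0n by auto
  ultimately have "\<mu> \<in> mat_eigenvalues A" by (auto simp: mat_eigenvalues_def)
  \<comment> \<open>The real \<open>Inf\<close> is meaningful only for a set bounded below; here
    \<mu> is a bound.\<close>
  moreover have "bdd_below (mat_eigenvalues A)"
  proof (rule bdd_belowI)
    fix \<nu> assume "\<nu> \<in> mat_eigenvalues A"
    then obtain y where y: "y \<noteq> 0" "A *v y = \<nu> *\<^sub>R y" by (auto simp: mat_eigenvalues_def)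
    then show "\<mu> \<le> \<nu>" using quad[of y] by (simp add: power2_norm_eq_inner)
  qed
  ultimately have "lambda_min A \<le> \<mu>" unfolding lambda_min_def by (intro cInf_lower)
  then have "lambda_min A * (norm x)\<^sup>2 \<le> \<mu> * (norm x)\<^sup>2" by (intro mult_right_mono) auto
  with quad[of x] show ?thesis by linarith
qed

lemma abs_inner_le:
  assumes "norm g \<le> b"
  shows "\<bar>g \<bullet> h\<bar> \<le> b * norm h"
  using Cauchy_Schwarz_ineq2[of g h] assms
  by (meson mult_right_mono norm_ge_zero order_trans)

lemma op_norm_bound:
  fixes A :: "real^'n^'m"
  shows "norm (A *v h) \<le> op_norm A * norm h"
  unfolding op_norm_def
  by (rule onorm) (simp add: matrix_vector_mul_bounded_linear)

section \<open>Radial functions\<close>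

text \<open>The norm is not differentiable at the origin, so \<open>f\<close> is taken constant near
  0. At the centre the stated gradient is 0 whatever its scalar factor, because \<open>x - c\<close>
  vanishes.\<close>

lemma radial_has_derivative:
  fixes c x :: "'a::euclidean_space"
  assumes f: "\<And>r. 0 < r \<Longrightarrow> (f has_real_derivative f' r) (at r)"
    and "0 < a" and const: "\<And>r. 0 \<le> r \<Longrightarrow> r < a \<Longrightarrow> f r = f 0"
  shows "((\<lambda>x. f (norm (x - c))) has_derivative
    (\<lambda>h. ((f' (norm (x - c)) / norm (x - c)) *\<^sub>R (x - c)) \<bullet> h)) (at x)"
proof (cases "x = c")
  case True
  have "f 0 = f (norm (y - c))" if "y \<in> ball c a" for y
    using const[of "norm (y - c)"] that by (simp add: dist_norm norm_minus_commute)
  then have "((\<lambda>x. f (norm (x - c))) has_derivative (\<lambda>h. 0)) (at x)"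
    by (rule has_derivative_transform_within_open[OF has_derivative_const open_ball, rotated])
      (use True \<open>0 < a\<close> in auto)
  then show ?thesis using True by simp
next
  case False
  then have pos: "norm (x - c) > 0" by simp
  have "((\<lambda>x. x - c) has_derivative (\<lambda>h. h)) (at x)"
    by (auto intro!: derivative_eq_intros)
  moreover have "(norm has_derivative (\<lambda>h. h \<bullet> sgn (x - c))) (at (x - c))"
    using False by (simp add: has_derivative_norm)
  ultimately have "((\<lambda>x. norm (x - c)) has_derivative (\<lambda>h. h \<bullet> sgn (x - c))) (at x)"
    by (rule has_derivative_compose)
  from has_derivative_compose[OF this f[OF pos, unfolded has_field_derivative_def]]
  show ?thesis by (simp add: sgn_div_norm inner_commute divide_inverse mult.assoc)
qed

text \<open>For nonzero \<open>y\<close> this is \<open>f''\<close> times the projection onto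
  \<open>y\<close> plus \<open>f' / norm y\<close> times the projection onto its orthogonal
  complement, arranged as the product rule for \<open>f' / norm y\<close> times \<open>y\<close>
  delivers it. At \<open>y = 0\<close> it is 0, since division by zero gives 0.\<close>

definition radial_hess :: "(real \<Rightarrow> real) \<Rightarrow> (real \<Rightarrow> real) \<Rightarrow> 'a::euclidean_space \<Rightarrow> 'a \<Rightarrow> 'a" where
  "radial_hess f' f'' y h =
     ((f'' (norm y) / norm y - f' (norm y) / (norm y)\<^sup>2) / norm y * (y \<bullet> h)) *\<^sub>R y
     + (f' (norm y) / norm y) *\<^sub>R h"

lemma radial_grad_has_derivative:
  fixes c x :: "'a::euclidean_space"
  assumes f': "\<And>r. 0 < r \<Longrightarrow> (f' has_real_derivative f'' r) (at r)"
    and "0 < a" and zero: "\<And>r. 0 \<le> r \<Longrightarrow> r < a \<Longrightarrow> f' r = 0"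
  shows "((\<lambda>x. (f' (norm (x - c)) / norm (x - c)) *\<^sub>R (x - c)) has_derivative
    radial_hess f' f'' (x - c)) (at x)"
proof -
  define k where "k r = f' r / r" for r
  define k' where "k' r = f'' r / r - f' r / r\<^sup>2" for r
  have "(k has_real_derivative k' r) (at r)" if "0 < r" for r
    unfolding k_def[abs_def] k'_def using that
    by (auto intro!: derivative_eq_intros f' simp: field_simps power2_eq_square)
  then have "((\<lambda>x. k (norm (x - c))) has_derivative
      (\<lambda>h. ((k' (norm (x - c)) / norm (x - c)) *\<^sub>R (x - c)) \<bullet> h)) (at x)"
    by (rule radial_has_derivative[OF _ \<open>0 < a\<close>]) (use \<open>0 < a\<close> zero in \<open>auto simp: k_def\<close>)
  then have "((\<lambda>x. k (norm (x - c)) *\<^sub>R (x - c)) has_derivative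
      (\<lambda>h. k (norm (x - c)) *\<^sub>R h + (((k' (norm (x - c)) / norm (x - c)) *\<^sub>R (x - c)) \<bullet> h) *\<^sub>R (x - c))) (at x)"
    by (auto intro!: derivative_eq_intros)
  moreover have "(\<lambda>h. k (norm (x - c)) *\<^sub>R h
      + (((k' (norm (x - c)) / norm (x - c)) *\<^sub>R (x - c)) \<bullet> h) *\<^sub>R (x - c)) = radial_hess f' f'' (x - c)"
    by (simp add: k_def k'_def radial_hess_def fun_eq_iff)
  ultimately show ?thesis by (simp add: k_def)
qed

text \<open>Splitting \<open>h\<close> into its component \<open>c\<close> along \<open>y\<close>
  and the rest diagonalises the form, with eigenvalues \<open>f''\<close> and
  \<open>f' / norm y\<close>.\<close>

lemma radial_hess_lower:
  assumes "q \<le> f'' (norm y)" "q \<le> f' (norm y) / norm y"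
  shows "q * (norm h)\<^sup>2 \<le> h \<bullet> radial_hess f' f'' y h"
proof (cases "y = 0")
  case True
  \<comment> \<open>At the origin \<open>f' 0 / 0\<close> is 0, so the second assumption reads
    \<open>q \<le> 0\<close>, as the vanishing form requires.\<close>
  then show ?thesis using assms by (auto simp: radial_hess_def mult_nonpos_nonneg)
next
  case False
  define c where "c = (y \<bullet> h) / norm y"
  have c: "(y \<bullet> h) = c * norm y" using False by (simp add: c_def)
  have "c\<^sup>2 \<le> (norm h)\<^sup>2"
    using Cauchy_Schwarz_ineq2[of y h] False
    by (intro power2_le_iff_abs_le[THEN iffD2]) (auto simp: c_def field_simps)
  then have "q * c\<^sup>2 + q * ((norm h)\<^sup>2 - c\<^sup>2)
      \<le> f'' (norm y) * c\<^sup>2 + f' (norm y) / norm y * ((norm h)\<^sup>2 - c\<^sup>2)"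
    using assms by (intro add_mono mult_right_mono) auto
  also have "\<dots> = h \<bullet> radial_hess f' f'' y h"
    using False by (simp add: radial_hess_def inner_add_right inner_commute[of h y] c
        power2_norm_eq_inner[of h, symmetric] power2_eq_square field_simps)
  finally show ?thesis by (simp add: algebra_simps)
qed

text \<open>The triangle inequality is cruder than the maximum of the two eigenvalues, but the
  constants leave room for it.\<close>

lemma radial_hess_norm_le:
  "norm (radial_hess f' f'' y h) \<le> (\<bar>f'' (norm y)\<bar> + 2 * \<bar>f' (norm y) / norm y\<bar>) * norm h"
proof (cases "y = 0")
  case True
  then show ?thesis by (simp add: radial_hess_def)
next
  case False
  define k where "k = f' (norm y) / norm y"
  have "norm (radial_hess f' f'' y h)
      \<le> norm (((f'' (norm y) / norm y - f' (norm y) / (norm y)\<^sup>2) / norm y * (y \<bullet> h)) *\<^sub>R y) + norm (k *\<^sub>R h)"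
    unfolding radial_hess_def k_def by (rule norm_triangle_ineq)
  also have "\<dots> = \<bar>f'' (norm y) - k\<bar> * (\<bar>y \<bullet> h\<bar> / norm y) + \<bar>k\<bar> * norm h"
  proof -
    have "f'' (norm y) / norm y - f' (norm y) / (norm y)\<^sup>2 = (f'' (norm y) - k) / norm y"
      using False by (simp add: k_def power2_eq_square field_simps)
    then show ?thesis using False by (simp add: abs_mult)
  qed
  also have "\<dots> \<le> (\<bar>f'' (norm y)\<bar> + \<bar>k\<bar>) * norm h + \<bar>k\<bar> * norm h"
    using Cauchy_Schwarz_ineq2[of y h] False
    by (intro add_right_mono mult_mono) (auto simp: field_simps)
  finally show ?thesis by (simp add: k_def algebra_simps)
qed

section \<open>The cutoff and the mollified penalty\<close>

lemma smooth_real_DERIV: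
  assumes "smooth_real f"
  shows "((deriv ^^ k) f has_real_derivative (deriv ^^ Suc k) f x) (at x)"
proof -
  have "(deriv ^^ k) f differentiable (at x)" using assms by (simp add: smooth_real_def)
  then show ?thesis
    by (simp add: DERIV_deriv_iff_real_differentiable)
qed

lemma smooth_real_continuous:
  assumes "smooth_real f"
  shows "continuous_on S ((deriv ^^ k) f)"
  using DERIV_isCont[OF smooth_real_DERIV[OF assms]] by (simp add: continuous_at_imp_continuous_on)

lemma continuous_eq_on_closure:
  fixes f :: "real \<Rightarrow> real"
  assumes "continuous_on UNIV f" "\<And>s. s \<in> S \<Longrightarrow> f s = c" "t \<in> closure S"
  shows "f t = c"
proof -
  have "closed {s. f s = c}"
    using assms(1) by (intro closed_Collect_eq) auto
  then have "closure S \<subseteq> {s. f s = c}"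
    using assms(2) by (intro closure_minimal) auto
  then show ?thesis using assms(3) by auto
qed

text \<open>Induction gives the claim on the open set, and continuity of each derivative carries it
  to the closure. The end points 3/4 and 7/8 of the transition zone are thereby included.\<close>

lemma smooth_real_deriv_zero:
  assumes "smooth_real f" "open S" "\<And>s. s \<in> S \<Longrightarrow> f s = c" "t \<in> closure S" "k > 0"
  shows "(deriv ^^ k) f t = 0"
proof (rule continuous_eq_on_closure[OF smooth_real_continuous[OF assms(1)] _ assms(4)])
  fix s assume "s \<in> S"
  then show "(deriv ^^ k) f s = 0"
    using \<open>k > 0\<close>
  proof (induction k arbitrary: s)
    case (Suc k)
    \<comment> \<open>The zeroth derivative is constantly \<open>c\<close>, all later ones are
      constantly 0.\<close>
    define c' where "c' = (if k = 0 then c else 0)"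
    have "(deriv ^^ k) f x = c'" if "x \<in> S" for x
      using Suc.IH[OF that] assms(3)[OF that] by (auto simp: c'_def)
    then have "((deriv ^^ k) f has_real_derivative 0) (at s)"
      using \<open>open S\<close> \<open>s \<in> S\<close> by (intro has_field_derivative_transform_within_open[OF DERIV_const[of c']]) auto
    then show ?case by (auto intro: DERIV_imp_deriv)
  qed simp
qed

lemma abs_deriv_le_C2_norm:
  assumes "bdd_above (range (\<lambda>x. \<bar>(deriv ^^ k) v x\<bar>))" "k \<le> 2"
  shows "\<bar>(deriv ^^ k) v x\<bar> \<le> C2_norm v"
proof -
  have "\<bar>(deriv ^^ k) v x\<bar> \<le> (SUP x. \<bar>(deriv ^^ k) v x\<bar>)"
    using assms(1) by (intro cSUP_upper) auto
  also have "\<dots> \<le> C2_norm v"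
    unfolding C2_norm_def using assms(2) by (intro Max_ge) auto
  finally show ?thesis .
qed

lemma cutoff_deriv_zero:
  assumes "smooth_real v" "\<And>t. t \<le> 3/4 \<Longrightarrow> v t = 1" "\<And>t. t > 7/8 \<Longrightarrow> v t = 0"
    and "k > 0" "t \<le> 3/4 \<or> 7/8 \<le> t"
  shows "(deriv ^^ k) v t = 0"
  using assms(5)
proof
  assume "t \<le> 3/4"
  then show ?thesis
    using assms by (intro smooth_real_deriv_zero[where S = "{..<3/4}" and c = 1]) auto
next
  assume "7/8 \<le> t"
  then show ?thesis
    using assms by (intro smooth_real_deriv_zero[where S = "{7/8<..}" and c = 0]) auto
qed

text \<open>The suprema in \<open>C2_norm\<close> say something only if they range over bounded
  sets. Compactness gives boundedness on [3/4, 7/8]; elsewhere \<open>v\<close> is 0 or 1 and its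
  derivatives vanish.\<close>

lemma cutoff_abs_deriv_le:
  assumes v: "smooth_real v" "\<And>t. t \<le> 3/4 \<Longrightarrow> v t = 1" "\<And>t. t > 7/8 \<Longrightarrow> v t = 0"
    and "k \<le> 2"
  shows "\<bar>(deriv ^^ k) v t\<bar> \<le> C2_norm v"
proof (rule abs_deriv_le_C2_norm[OF _ \<open>k \<le> 2\<close>])
  have "bounded ((deriv ^^ k) v ` {3/4..7/8})"
    by (intro compact_imp_bounded compact_continuous_image smooth_real_continuous v) auto
  then obtain b where b: "\<And>t. t \<in> {3/4..7/8} \<Longrightarrow> \<bar>(deriv ^^ k) v t\<bar> \<le> b"
    unfolding bounded_iff by fastforce
  have "\<bar>(deriv ^^ k) v t\<bar> \<le> max b 1" for t
  proof (cases "t \<in> {3/4..7/8}")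
    case True
    then show ?thesis using b by fastforce
  next
    case False
    then show ?thesis using v cutoff_deriv_zero[OF v, of k t] by (cases "k = 0") auto
  qed
  then show "bdd_above (range (\<lambda>x. \<bar>(deriv ^^ k) v x\<bar>))"
    by (intro bdd_aboveI[where M = "max b 1"]) auto
qed

text \<open>In the variable \<open>s = 8 t / \<eta> - 5\<close> the function \<open>v_eta \<phi> \<eta> t\<close> is \<open>(\<eta>/8)\<^sup>2\<close> times the integral
  of \<open>(s - z)\<^sup>2 \<phi> z\<close> over \<open>z \<le> s\<close>, which expands into truncated moments of \<open>\<phi>\<close>. Only
  \<open>t \<ge> 0\<close>, that is \<open>s \<ge> -5\<close>, matters, so any lower limit below \<open>-5\<close> will do.\<close>

locale mollifier =
  fixes \<phi> :: "real \<Rightarrow> real"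
  assumes cont: "continuous_on UNIV \<phi>"
    and nonneg: "\<phi> x \<ge> 0"
    and even: "\<phi> (- x) = \<phi> x"
    and supp: "\<bar>x\<bar> > 1 \<Longrightarrow> \<phi> x = 0"
    and integral_1: "(\<integral>x. \<phi> x \<partial>lborel) = 1"
begin

section \<open>Truncated moments of the mollifier and the derivatives of the penalty\<close>

definition moment :: "nat \<Rightarrow> real \<Rightarrow> real" where
  "moment k s = integral {-6..s} (\<lambda>z. z ^ k * \<phi> z)"

lemma moment_integrand_continuous: "continuous_on S (\<lambda>z. z ^ k * \<phi> z)"
  by (intro continuous_intros continuous_on_subset[OF cont]) auto

lemma moment_DERIV:
  assumes "s > -6"
  shows "(moment k has_real_derivative s ^ k * \<phi> s) (at s)"
proof -
  have "((\<lambda>u. integral {-6..u} (\<lambda>z. z ^ k * \<phi> z)) has_real_derivative s ^ k * \<phi> s)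
      (at s within {-6..s+1})"
    using assms by (intro integral_has_real_derivative moment_integrand_continuous) auto
  moreover have "at s within {-6..s+1} = at s"
    using assms by (intro at_within_interior) auto
  ultimately show ?thesis by (simp add: moment_def[abs_def])
qed

text \<open>Passes from the Lebesgue integral in \<open>conv\<close> to a gauge integral over an
  interval, where the fundamental theorem of calculus is available.\<close>

lemma lborel_integral_truncate:
  fixes g :: "real \<Rightarrow> real"
  assumes "continuous_on UNIV g" "\<And>z. z < -1 \<Longrightarrow> g z = 0"
  shows "(\<integral>z. (if z \<le> s then g z else 0) \<partial>lborel) = integral {-6..s} g"
proof -
  have "set_integrable lborel {-6..s} g"
    using assms(1) by (intro borel_integrable_atLeastAtMost') (auto intro: continuous_on_subset)
  then have "(LINT z:{-6..s}|lborel. g z) = integral {-6..s} g"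
    by (rule set_borel_integral_eq_integral)
  moreover have "(LINT z:{-6..s}|lborel. g z) = (\<integral>z. (if z \<le> s then g z else 0) \<partial>lborel)"
    unfolding set_lebesgue_integral_def
    by (intro Bochner_Integration.integral_cong) (auto simp: assms(2) indicator_def)
  ultimately show ?thesis by simp
qed

lemma moment_eq_full:
  assumes "s \<ge> 1"
  shows "moment k s = (\<integral>z. z ^ k * \<phi> z \<partial>lborel)"
proof -
  have "moment k s = (\<integral>z. (if z \<le> s then z ^ k * \<phi> z else 0) \<partial>lborel)"
    unfolding moment_def
    by (intro lborel_integral_truncate[symmetric] moment_integrand_continuous) (simp add: supp)
  also have "\<dots> = (\<integral>z. z ^ k * \<phi> z \<partial>lborel)"
    using assms by (intro Bochner_Integration.integral_cong) (auto simp: supp)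
  finally show ?thesis .
qed

lemma moment_0_ge: "s \<ge> 1 \<Longrightarrow> moment 0 s = 1"
  by (simp add: moment_eq_full integral_1)

lemma moment_0_bounds: "0 \<le> moment 0 s" "moment 0 s \<le> 1"
proof -
  have int: "(\<lambda>z. z ^ 0 * \<phi> z) integrable_on {-6..s}" for s
    by (intro integrable_continuous_interval moment_integrand_continuous)
  show "0 \<le> moment 0 s"
    unfolding moment_def using int by (rule integral_nonneg) (simp add: nonneg)
  have "moment 0 s \<le> moment 0 (max s 1)"
    unfolding moment_def by (rule integral_subset_le[OF _ int int]) (auto simp: nonneg)
  then show "moment 0 s \<le> 1" by (simp add: moment_0_ge)
qed

text \<open>Reflection shows that the full first moment equals its own negative. Hence
  \<open>v_eta'\<close> is exactly linear once the mollifier has passed the kink.\<close>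

lemma moment_1_ge:
  assumes "s \<ge> 1"
  shows "moment 1 s = 0"
proof -
  have "(\<integral>z. z * \<phi> z \<partial>lborel) = (\<integral>z. - (z * \<phi> z) \<partial>lborel)"
    using lborel_integral_real_affine[of "-1" "\<lambda>z. z * \<phi> z" 0] by (simp add: even)
  also have "\<dots> = - (\<integral>z. z * \<phi> z \<partial>lborel)"
    by simp
  finally show ?thesis by (simp add: moment_eq_full[OF assms])
qed

definition v_eta' :: "real \<Rightarrow> real \<Rightarrow> real" where
  "v_eta' \<eta> t = \<eta> / 4 * ((8 * t / \<eta> - 5) * moment 0 (8 * t / \<eta> - 5) - moment 1 (8 * t / \<eta> - 5))"

definition v_eta'' :: "real \<Rightarrow> real \<Rightarrow> real" where
  "v_eta'' \<eta> t = 2 * moment 0 (8 * t / \<eta> - 5)"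

text \<open>The substitution \<open>y = t - c * z\<close> with \<open>c = \<eta> / 8\<close> moves
  the kink to \<open>z = s\<close>. Its Jacobian cancels the factor \<open>1 / c\<close> of the
  mollifier, and the square leaves \<open>c\<^sup>2\<close>.\<close>

lemma v_eta_eq_integral:
  assumes "\<eta> > 0" and s: "s = 8 * t / \<eta> - 5"
  shows "v_eta \<phi> \<eta> t = (\<eta> / 8)\<^sup>2 * integral {-6..s} (\<lambda>z. (s - z)\<^sup>2 * \<phi> z)"
proof -
  define c where "c = \<eta> / 8"
  have c: "c > 0" "\<eta> = 8 * c" using assms by (auto simp: c_def)
  have t: "t = c * (s + 5)" using c s by (simp add: field_simps)
  have "v_eta \<phi> \<eta> t = (\<integral>y. \<phi> ((t - y) / c) / c * gamma_eta \<eta> y \<partial>lborel)"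
    by (simp add: v_eta_def conv_def moll_def c_def)
  also have "\<dots> = c * (\<integral>z. \<phi> ((t - (t + - c * z)) / c) / c * gamma_eta \<eta> (t + - c * z) \<partial>lborel)"
    using c lborel_integral_real_affine[of "-c" "\<lambda>y. \<phi> ((t - y) / c) / c * gamma_eta \<eta> y" t] by simp
  also have "(\<lambda>z. \<phi> ((t - (t + - c * z)) / c) / c * gamma_eta \<eta> (t + - c * z))
      = (\<lambda>z. c * (if z \<le> s then (s - z)\<^sup>2 * \<phi> z else 0))"
  proof
    fix z
    have "t + - c * z < 5 * \<eta> / 8 \<longleftrightarrow> c * s < c * z"
      using c by (simp add: t algebra_simps)
    also have "\<dots> \<longleftrightarrow> s < z" using c by simp
    finally have iff: "t + - c * z < 5 * \<eta> / 8 \<longleftrightarrow> s < z" .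
    have "t + - c * z - 5 * \<eta> / 8 = c * (s - z)"
      using c by (simp add: t algebra_simps)
    then have "gamma_eta \<eta> (t + - c * z) = (if z \<le> s then (c * (s - z))\<^sup>2 else 0)"
      unfolding gamma_eta_def iff by auto
    then show "\<phi> ((t - (t + - c * z)) / c) / c * gamma_eta \<eta> (t + - c * z)
        = c * (if z \<le> s then (s - z)\<^sup>2 * \<phi> z else 0)"
      using c by (simp add: power2_eq_square field_simps)
  qed
  also have "(\<integral>z. c * (if z \<le> s then (s - z)\<^sup>2 * \<phi> z else 0) \<partial>lborel)
      = c * (\<integral>z. (if z \<le> s then (s - z)\<^sup>2 * \<phi> z else 0) \<partial>lborel)"
    by simp
  also have "(\<integral>z. (if z \<le> s then (s - z)\<^sup>2 * \<phi> z else 0) \<partial>lborel)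
      = integral {-6..s} (\<lambda>z. (s - z)\<^sup>2 * \<phi> z)"
    by (intro lborel_integral_truncate continuous_intros cont) (simp add: supp)
  finally show ?thesis by (simp add: c_def power2_eq_square)
qed

lemma integral_square_eq_moments:
  "integral {-6..s} (\<lambda>z. (s - z)\<^sup>2 * \<phi> z) = s\<^sup>2 * moment 0 s - 2 * s * moment 1 s + moment 2 s"
proof -
  have int: "(\<lambda>z. z ^ k * \<phi> z) integrable_on {-6..s}" for k
    by (intro integrable_continuous_interval moment_integrand_continuous)
  have "(\<lambda>z. (s - z)\<^sup>2 * \<phi> z)
      = (\<lambda>z. s\<^sup>2 * (z ^ 0 * \<phi> z) - 2 * s * (z ^ 1 * \<phi> z) + z ^ 2 * \<phi> z)"
    by (simp add: fun_eq_iff power2_eq_square algebra_simps)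
  then have "integral {-6..s} (\<lambda>z. (s - z)\<^sup>2 * \<phi> z)
      = integral {-6..s} (\<lambda>z. s\<^sup>2 * (z ^ 0 * \<phi> z) - 2 * s * (z ^ 1 * \<phi> z) + z ^ 2 * \<phi> z)"
    by (rule arg_cong)
  also have "\<dots> = s\<^sup>2 * moment 0 s - 2 * s * moment 1 s + moment 2 s"
    unfolding moment_def
    by (intro integral_unique has_integral_add has_integral_diff has_integral_mult_right
        integrable_integral int)
  finally show ?thesis .
qed

lemma integral_linear_eq_moments:
  "((\<lambda>z. (s - z) * \<phi> z) has_integral (s * moment 0 s - moment 1 s)) {-6..s}"
proof -
  have int: "(\<lambda>z. z ^ k * \<phi> z) integrable_on {-6..s}" for k
    by (intro integrable_continuous_interval moment_integrand_continuous)
  have "(\<lambda>z. (s - z) * \<phi> z) = (\<lambda>z. s * (z ^ 0 * \<phi> z) - z ^ 1 * \<phi> z)"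
    by (simp add: fun_eq_iff algebra_simps)
  then show ?thesis
    unfolding moment_def
    by (simp only:) (intro has_integral_diff has_integral_mult_right integrable_integral int)
qed

text \<open>The terms from differentiating the three moments cancel, as
  \<open>s\<^sup>2 - 2 * s * s + s\<^sup>2 = 0\<close> multiplies \<open>\<phi> s\<close>.\<close>

lemma v_eta_DERIV:
  assumes "\<eta> > 0" "t > 0"
  shows "(v_eta \<phi> \<eta> has_real_derivative v_eta' \<eta> t) (at t)"
proof -
  define W where "W s = s\<^sup>2 * moment 0 s - 2 * s * moment 1 s + moment 2 s" for s
  define s where "s = 8 * t / \<eta> - 5"
  have "s > -6" using assms by (simp add: s_def add_pos_pos less_le_trans[of _ 0])
  have "(W has_real_derivative 2 * (s * moment 0 s - moment 1 s)) (at s)"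
    unfolding W_def
    by (rule derivative_eq_intros moment_DERIV[OF \<open>s > -6\<close>] refl)+
      (simp add: power2_eq_square algebra_simps)
  then have "((\<lambda>t. W (8 * t / \<eta> - 5)) has_real_derivative
      2 * (s * moment 0 s - moment 1 s) * (8 / \<eta>)) (at t)"
    unfolding s_def
    by (rule DERIV_chain2) (use assms in \<open>auto intro!: derivative_eq_intros simp: field_simps\<close>)
  then have "((\<lambda>t. (\<eta> / 8)\<^sup>2 * W (8 * t / \<eta> - 5)) has_real_derivative
      (\<eta> / 8)\<^sup>2 * (2 * (s * moment 0 s - moment 1 s) * (8 / \<eta>))) (at t)"
    by (rule DERIV_cmult)
  moreover have "v_eta \<phi> \<eta> = (\<lambda>t. (\<eta> / 8)\<^sup>2 * W (8 * t / \<eta> - 5))"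
    using v_eta_eq_integral[OF \<open>\<eta> > 0\<close> refl] by (simp add: fun_eq_iff W_def integral_square_eq_moments)
  moreover have "(\<eta> / 8)\<^sup>2 * (2 * (s * moment 0 s - moment 1 s) * (8 / \<eta>)) = v_eta' \<eta> t"
    using assms by (simp add: v_eta'_def s_def power2_eq_square field_simps)
  ultimately show ?thesis by simp
qed

lemma v_eta'_DERIV:
  assumes "\<eta> > 0" "t > 0"
  shows "(v_eta' \<eta> has_real_derivative v_eta'' \<eta> t) (at t)"
proof -
  define s where "s = 8 * t / \<eta> - 5"
  have "s > -6" using assms by (simp add: s_def add_pos_pos less_le_trans[of _ 0])
  have "((\<lambda>s. s * moment 0 s - moment 1 s) has_real_derivative moment 0 s) (at s)"
    by (rule derivative_eq_intros moment_DERIV[OF \<open>s > -6\<close>] refl)+ simp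
  then have "((\<lambda>t. (\<lambda>s. s * moment 0 s - moment 1 s) (8 * t / \<eta> - 5)) has_real_derivative
      moment 0 s * (8 / \<eta>)) (at t)"
    unfolding s_def
    by (rule DERIV_chain2) (use assms in \<open>auto intro!: derivative_eq_intros simp: field_simps\<close>)
  then have "((\<lambda>t. \<eta> / 4 * ((8 * t / \<eta> - 5) * moment 0 (8 * t / \<eta> - 5) - moment 1 (8 * t / \<eta> - 5)))
      has_real_derivative \<eta> / 4 * (moment 0 s * (8 / \<eta>))) (at t)"
    by (intro DERIV_cmult) simp
  then show ?thesis
    using assms by (simp add: v_eta'_def[abs_def] v_eta''_def s_def)
qed

lemma v_eta_zero:
  assumes "\<eta> > 0" "t \<le> \<eta> / 2"
  shows "v_eta \<phi> \<eta> t = 0"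
proof -
  define s where "s = 8 * t / \<eta> - 5"
  have "s \<le> -1" using assms by (simp add: s_def field_simps)
  then have "(s - z)\<^sup>2 * \<phi> z = 0" if "z \<in> {-6..s}" for z
    \<comment> \<open>The support condition leaves \<open>z = -1\<close> open, but there
      \<open>z \<le> s \<le> -1\<close> forces \<open>s = z\<close> and the square vanishes.\<close>
    using that by (cases "z = -1") (auto simp: supp)
  then have "integral {-6..s} (\<lambda>z. (s - z)\<^sup>2 * \<phi> z) = integral {-6..s} (\<lambda>z. 0)"
    by (rule integral_cong)
  then show ?thesis using v_eta_eq_integral[OF \<open>\<eta> > 0\<close> s_def] by simp
qed

lemma v_eta'_eq:
  assumes "s = 8 * t / \<eta> - 5"
  shows "v_eta' \<eta> t = \<eta> / 4 * integral {-6..s} (\<lambda>z. (s - z) * \<phi> z)"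
  using assms integral_unique[OF integral_linear_eq_moments] by (simp add: v_eta'_def)

lemma v_eta'_zero:
  assumes "\<eta> > 0" "t \<le> \<eta> / 2"
  shows "v_eta' \<eta> t = 0"
proof -
  define s where "s = 8 * t / \<eta> - 5"
  have "s \<le> -1" using assms by (simp add: s_def field_simps)
  then have "(s - z) * \<phi> z = 0" if "z \<in> {-6..s}" for z
    using that by (cases "z = -1") (auto simp: supp)
  then have "integral {-6..s} (\<lambda>z. (s - z) * \<phi> z) = integral {-6..s} (\<lambda>z. 0)"
    by (rule integral_cong)
  then show ?thesis using v_eta'_eq[OF s_def] by simp
qed

lemma v_eta'_nonneg:
  assumes "\<eta> > 0"
  shows "0 \<le> v_eta' \<eta> t"
proof -
  define s where "s = 8 * t / \<eta> - 5"
  have "0 \<le> s * moment 0 s - moment 1 s"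
    by (rule has_integral_nonneg[OF integral_linear_eq_moments]) (simp add: nonneg)
  then show ?thesis using assms by (simp add: v_eta'_def s_def)
qed

text \<open>On the support of \<phi> one has \<open>s - z \<le> s + 5\<close>, and
  \<open>s + 5 = 8 * t / \<eta>\<close>. The slack in 5 is what turns the bound into exactly
  \<open>2 * t\<close>.\<close>

lemma v_eta'_le:
  assumes "\<eta> > 0" "t \<ge> 0"
  shows "v_eta' \<eta> t \<le> 2 * t"
proof -
  define s where "s = 8 * t / \<eta> - 5"
  have "(\<lambda>z. z ^ 0 * \<phi> z) integrable_on {-6..s}"
    by (intro integrable_continuous_interval moment_integrand_continuous)
  then have "((\<lambda>z. (s + 5) * (z ^ 0 * \<phi> z)) has_integral (s + 5) * moment 0 s) {-6..s}"
    unfolding moment_def by (intro has_integral_mult_right integrable_integral)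
  then have "s * moment 0 s - moment 1 s \<le> (s + 5) * moment 0 s"
  proof (rule has_integral_le[OF integral_linear_eq_moments])
    fix z show "(s - z) * \<phi> z \<le> (s + 5) * (z ^ 0 * \<phi> z)"
      using nonneg[of z] supp[of z] by (cases "z < -1") (auto intro: mult_right_mono)
  qed
  also have "\<dots> \<le> s + 5"
    using assms moment_0_bounds[of s] by (intro mult_left_le) (auto simp: s_def)
  finally have "\<eta> / 4 * (s * moment 0 s - moment 1 s) \<le> \<eta> / 4 * (s + 5)"
    using assms by simp
  also have "\<dots> = 2 * t" using assms by (simp add: s_def)
  finally show ?thesis by (simp add: v_eta'_def s_def)
qed

lemma v_eta''_bounds: "0 \<le> v_eta'' \<eta> t" "v_eta'' \<eta> t \<le> 2"
  using moment_0_bounds by (auto simp: v_eta''_def)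

text \<open>Here \<open>v_eta'\<close> is \<open>2 * (t - 5 * \<eta> / 8)\<close>, and its quotient
  by \<open>t\<close> is smallest at \<open>t = 3 * \<eta> / 4\<close>, where it is 2 * (1 - 5/6) =
  1/3.\<close>

lemma v_eta_far:
  assumes "\<eta> > 0" "t \<ge> 3 * \<eta> / 4"
  shows "v_eta'' \<eta> t = 2" "1 / 3 \<le> v_eta' \<eta> t / t"
proof -
  have "8 * t / \<eta> - 5 \<ge> 1" using assms by (simp add: field_simps)
  then show "v_eta'' \<eta> t = 2" "1 / 3 \<le> v_eta' \<eta> t / t"
    using assms by (auto simp: v_eta''_def v_eta'_def moment_0_ge moment_1_ge[unfolded One_nat_def] field_simps)
qed

end

section \<open>The surrogate log-likelihood\<close>

text \<open>Here \<open>a\<close> stands for \<open>c\<^sub>m\<^sub>a\<^sub>x n\<close> and \<open>P\<close> for \<open>p powr \<kappa>\<^sub>2\<close>; since \<open>ln n \<ge> 1/2\<close>, the bound on the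
  gradient at \<open>\<theta>star\<close> gives \<open>grad_star\<close>.\<close>

locale local_surrogate = mollifier \<phi> for \<phi> :: "real \<Rightarrow> real" +
  fixes l :: "real^'p \<Rightarrow> real" and gradl :: "real^'p \<Rightarrow> real^'p" and hessl :: "real^'p \<Rightarrow> real^'p^'p"
    and \<theta>star \<theta>init :: "real^'p" and \<eta> a P m K :: real and v :: "real \<Rightarrow> real"
  assumes eta_pos: "\<eta> > 0"
    and l_grad: "\<And>\<theta>. \<theta> \<in> cball \<theta>star \<eta> \<Longrightarrow>
      (l has_derivative (\<lambda>h. gradl \<theta> \<bullet> h)) (at \<theta> within cball \<theta>star \<eta>)"
    and l_hess: "\<And>\<theta>. \<theta> \<in> cball \<theta>star \<eta> \<Longrightarrow>
      (gradl has_derivative (\<lambda>h. hessl \<theta> *v h)) (at \<theta> within cball \<theta>star \<eta>)"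
    and grad_star: "norm (gradl \<theta>star) \<le> 2 * a * \<eta>"
    and hess_upper: "\<And>\<theta>. \<theta> \<in> cball \<theta>star \<eta> \<Longrightarrow> op_norm (hessl \<theta>) \<le> a * P"
    and hess_lower: "\<And>\<theta>. \<theta> \<in> cball \<theta>star \<eta> \<Longrightarrow> m \<le> lambda_min (- hessl \<theta>)"
    and init_close: "norm (\<theta>init - \<theta>star) \<le> \<eta> / 8"
    and m_pos: "0 < m" and m_le: "m \<le> a" and P_ge: "P \<ge> 1"
    and v_smooth: "smooth_real v" and v_range: "\<And>t. 0 \<le> v t" "\<And>t. v t \<le> 1"
    and v_one: "\<And>t. t \<le> 3/4 \<Longrightarrow> v t = 1" and v_zero: "\<And>t. t > 7/8 \<Longrightarrow> v t = 0"
    and K_ge: "K \<ge> 60 * a * C2_norm v * (1 + P)"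
begin

abbreviation "N \<equiv> C2_norm v"

abbreviation "r \<theta> \<equiv> norm (\<theta> - \<theta>init)"

lemma a_pos: "a > 0"
  using m_pos m_le by simp

lemma v_abs_deriv_le: "k \<le> 2 \<Longrightarrow> \<bar>(deriv ^^ k) v t\<bar> \<le> N"
  using v_smooth v_one v_zero by (rule cutoff_abs_deriv_le)

lemma N_ge_1: "N \<ge> 1"
  using v_abs_deriv_le[of 0 0] v_one[of 0] by simp

lemma v_zero': "t \<ge> 7/8 \<Longrightarrow> v t = 0"
  by (rule continuous_eq_on_closure[where S = "{7/8<..}"])
    (use v_zero smooth_real_continuous[OF v_smooth, of UNIV 0] in auto)

section \<open>The rescaled cutoff and the penalty as radial functions\<close>

definition cut :: "real \<Rightarrow> real" where "cut t = v (t / \<eta>)"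
definition cut' :: "real \<Rightarrow> real" where "cut' t = (deriv ^^ 1) v (t / \<eta>) / \<eta>"
definition cut'' :: "real \<Rightarrow> real" where "cut'' t = (deriv ^^ 2) v (t / \<eta>) / \<eta>\<^sup>2"

lemma cut_DERIV: "(cut has_real_derivative cut' t) (at t)"
proof -
  have "((\<lambda>t. v (t / \<eta>)) has_real_derivative (deriv ^^ Suc 0) v (t / \<eta>) * (1 / \<eta>)) (at t)"
    using smooth_real_DERIV[OF v_smooth, of 0 "t / \<eta>"] eta_pos
    by (intro DERIV_chain2) (auto intro!: derivative_eq_intros)
  then show ?thesis by (simp add: cut_def[abs_def] cut'_def)
qed

lemma cut'_DERIV: "(cut' has_real_derivative cut'' t) (at t)"
proof -
  have "((\<lambda>t. (deriv ^^ 1) v (t / \<eta>)) has_real_derivative (deriv ^^ Suc 1) v (t / \<eta>) * (1 / \<eta>)) (at t)"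
    using smooth_real_DERIV[OF v_smooth, of 1 "t / \<eta>"] eta_pos
    by (intro DERIV_chain2) (auto intro!: derivative_eq_intros)
  then have "((\<lambda>t. (deriv ^^ 1) v (t / \<eta>) / \<eta>) has_real_derivative
      (deriv ^^ Suc 1) v (t / \<eta>) * (1 / \<eta>) / \<eta>) (at t)"
    by (rule DERIV_cdivide)
  then show ?thesis
    unfolding cut'_def[abs_def] cut''_def by (simp add: power2_eq_square numeral_2_eq_2)
qed

lemma cut_inner: "t \<le> 3 * \<eta> / 4 \<Longrightarrow> cut t = 1"
  unfolding cut_def using eta_pos by (intro v_one) (simp add: field_simps)

lemma cut_outer: "t \<ge> 7 * \<eta> / 8 \<Longrightarrow> cut t = 0"
  unfolding cut_def using eta_pos by (intro v_zero') (simp add: field_simps)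

lemma cut_deriv_zero:
  assumes "t \<le> 3 * \<eta> / 4 \<or> t \<ge> 7 * \<eta> / 8"
  shows "cut' t = 0" "cut'' t = 0"
proof -
  have "t / \<eta> \<le> 3/4 \<or> 7/8 \<le> t / \<eta>" using assms eta_pos by (auto simp: field_simps)
  then have "(deriv ^^ k) v (t / \<eta>) = 0" if "k > 0" for k
    using cutoff_deriv_zero[OF v_smooth v_one v_zero that] by blast
  then show "cut' t = 0" "cut'' t = 0" by (simp_all add: cut'_def cut''_def del: funpow.simps One_nat_def)
qed

lemma cut'_le: "\<bar>cut' t\<bar> \<le> N / \<eta>"
  using v_abs_deriv_le[of 1 "t / \<eta>"] eta_pos
  by (simp add: cut'_def divide_right_mono del: funpow.simps One_nat_def)

lemma cut''_le: "\<bar>cut'' t\<bar> \<le> N / \<eta>\<^sup>2"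
  using v_abs_deriv_le[of 2 "t / \<eta>"] eta_pos
  by (simp add: cut''_def divide_right_mono del: funpow.simps One_nat_def)

definition cut_grad :: "real^'p \<Rightarrow> real^'p" where
  "cut_grad \<theta> = (cut' (r \<theta>) / r \<theta>) *\<^sub>R (\<theta> - \<theta>init)"

definition cut_hess :: "real^'p \<Rightarrow> real^'p \<Rightarrow> real^'p" where
  "cut_hess \<theta> = radial_hess cut' cut'' (\<theta> - \<theta>init)"

lemma cut_has_derivative: "((\<lambda>\<theta>. cut (r \<theta>)) has_derivative (\<lambda>h. cut_grad \<theta> \<bullet> h)) (at \<theta>)"
  unfolding cut_grad_def
  by (rule radial_has_derivative[OF cut_DERIV, of "\<eta> / 2"]) (use eta_pos cut_inner in auto)

lemma cut_grad_has_derivative: "(cut_grad has_derivative cut_hess \<theta>) (at \<theta>)"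
  unfolding cut_grad_def[abs_def] cut_hess_def
  by (rule radial_grad_has_derivative[OF cut'_DERIV, of "\<eta> / 2"]) (use eta_pos cut_deriv_zero in auto)

definition tail_grad :: "real^'p \<Rightarrow> real^'p" where
  "tail_grad \<theta> = (v_eta' \<eta> (r \<theta>) / r \<theta>) *\<^sub>R (\<theta> - \<theta>init)"

definition tail_hess :: "real^'p \<Rightarrow> real^'p \<Rightarrow> real^'p" where
  "tail_hess \<theta> = radial_hess (v_eta' \<eta>) (v_eta'' \<eta>) (\<theta> - \<theta>init)"

lemma tail_has_derivative: "((\<lambda>\<theta>. v_eta \<phi> \<eta> (r \<theta>)) has_derivative (\<lambda>h. tail_grad \<theta> \<bullet> h)) (at \<theta>)"
  unfolding tail_grad_def
  by (rule radial_has_derivative[OF v_eta_DERIV[OF eta_pos], of "\<eta> / 2"])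
    (use eta_pos v_eta_zero in auto)

lemma tail_grad_has_derivative: "(tail_grad has_derivative tail_hess \<theta>) (at \<theta>)"
  unfolding tail_grad_def[abs_def] tail_hess_def
  by (rule radial_grad_has_derivative[OF v_eta'_DERIV[OF eta_pos], of "\<eta> / 2"])
    (use eta_pos v_eta'_zero in auto)

section \<open>The log-likelihood on the ball around \<open>\<theta>star\<close>\<close>

lemma cball_init_subset: "r \<theta> \<le> 7 * \<eta> / 8 \<Longrightarrow> \<theta> \<in> cball \<theta>star \<eta>"
  using init_close norm_triangle_ineq[of "\<theta> - \<theta>init" "\<theta>init - \<theta>star"]
  by (simp add: dist_norm norm_minus_commute)

lemma ball_init_interior: "r \<theta> < 7 * \<eta> / 8 \<Longrightarrow> \<theta> \<in> ball \<theta>star \<eta>"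
  using init_close norm_triangle_ineq[of "\<theta> - \<theta>init" "\<theta>init - \<theta>star"]
  by (simp add: dist_norm norm_minus_commute)

lemma at_within_cball: "\<theta> \<in> ball \<theta>star \<eta> \<Longrightarrow> at \<theta> within cball \<theta>star \<eta> = at \<theta>"
  by (rule at_within_interior) simp

lemma l_grad_at: "\<theta> \<in> ball \<theta>star \<eta> \<Longrightarrow> (l has_derivative (\<lambda>h. gradl \<theta> \<bullet> h)) (at \<theta>)"
  using l_grad[OF subsetD[OF ball_subset_cball]] at_within_cball by metis

lemma l_hess_at: "\<theta> \<in> ball \<theta>star \<eta> \<Longrightarrow> (gradl has_derivative (\<lambda>h. hessl \<theta> *v h)) (at \<theta>)"
  using l_hess[OF subsetD[OF ball_subset_cball]] at_within_cball by metis

lemma hessl_norm_le: "\<theta> \<in> cball \<theta>star \<eta> \<Longrightarrow> norm (hessl \<theta> *v h) \<le> a * P * norm h"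
  using op_norm_bound[of "hessl \<theta>" h] hess_upper[of \<theta>]
  by (meson mult_right_mono norm_ge_zero order_trans)

text \<open>Restricted to the open ball because symmetry of the Hessian needs full derivatives in a
  neighbourhood.\<close>

lemma hessl_quadratic_form_le:
  assumes "\<theta> \<in> ball \<theta>star \<eta>"
  shows "h \<bullet> (hessl \<theta> *v h) \<le> - m * (norm h)\<^sup>2"
proof -
  have minus: "- hessl \<theta> *v x = - (hessl \<theta> *v x)" for x
    by (simp add: vec_eq_iff matrix_vector_mult_def sum_negf)
  have "x \<bullet> (- hessl \<theta> *v y) = y \<bullet> (- hessl \<theta> *v x)" for x y
    using symmetric_second_derivative[OF open_ball assms l_grad_at l_hess_at[OF assms], of x y]
    by (simp add: minus)
  then have "lambda_min (- hessl \<theta>) * (norm h)\<^sup>2 \<le> h \<bullet> (- hessl \<theta> *v h)"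
    by (rule lambda_min_le_quadratic_form)
  moreover have "m * (norm h)\<^sup>2 \<le> lambda_min (- hessl \<theta>) * (norm h)\<^sup>2"
    using assms by (intro mult_right_mono hess_lower) auto
  ultimately show ?thesis by (simp add: minus)
qed

lemma gradl_norm_le:
  assumes "\<theta> \<in> cball \<theta>star \<eta>"
  shows "norm (gradl \<theta>) \<le> a * \<eta> * (2 + P)"
proof -
  have "norm (gradl \<theta> - gradl \<theta>star) \<le> a * P * norm (\<theta> - \<theta>star)"
    by (rule differentiable_bound[OF convex_cball l_hess])
      (use assms eta_pos hessl_norm_le in \<open>auto intro!: onorm_le\<close>)
  also have "\<dots> \<le> a * P * \<eta>"
    using assms a_pos P_ge by (intro mult_left_mono) (auto simp: dist_norm norm_minus_commute)
  finally show ?thesis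
    using grad_star norm_triangle_sub[of "gradl \<theta>" "gradl \<theta>star"] by (simp add: algebra_simps)
qed

lemma l_diff_le:
  assumes "r \<theta> \<le> 7 * \<eta> / 8"
  shows "\<bar>l \<theta> - l \<theta>init\<bar> \<le> 7 / 8 * (a * \<eta>\<^sup>2 * (2 + P))"
proof -
  have "norm (l \<theta> - l \<theta>init) \<le> a * \<eta> * (2 + P) * norm (\<theta> - \<theta>init)"
  proof (rule differentiable_bound[OF convex_cball l_grad])
    fix x assume "x \<in> cball \<theta>star \<eta>"
    then show "onorm ((\<bullet>) (gradl x)) \<le> a * \<eta> * (2 + P)"
      using abs_inner_le[OF gradl_norm_le] by (intro onorm_le) simp
  qed (use assms cball_init_subset[of \<theta>] cball_init_subset[of \<theta>init] eta_pos in auto)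
  also have "\<dots> \<le> a * \<eta> * (2 + P) * (7 * \<eta> / 8)"
    using assms a_pos eta_pos P_ge by (intro mult_left_mono) auto
  finally show ?thesis by (simp add: power2_eq_square mult_ac)
qed

section \<open>First and second derivative of the surrogate\<close>

definition surr_grad :: "real^'p \<Rightarrow> real^'p" where
  "surr_grad \<theta> = (l \<theta> - l \<theta>init) *\<^sub>R cut_grad \<theta> + cut (r \<theta>) *\<^sub>R gradl \<theta> - K *\<^sub>R tail_grad \<theta>"

text \<open>Second-order product rule, with one cross term for each order of the two gradients. From
  radius 7\<eta>/8 on it is set to 0, since \<open>gradl\<close> and \<open>hessl\<close> may carry
  no information there.\<close>

definition cut_l_hess :: "real^'p \<Rightarrow> real^'p \<Rightarrow> real^'p" where
  "cut_l_hess \<theta> h = (if r \<theta> < 7 * \<eta> / 8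
     then (gradl \<theta> \<bullet> h) *\<^sub>R cut_grad \<theta> + (l \<theta> - l \<theta>init) *\<^sub>R cut_hess \<theta> h
       + (cut_grad \<theta> \<bullet> h) *\<^sub>R gradl \<theta> + cut (r \<theta>) *\<^sub>R (hessl \<theta> *v h)
     else 0)"

definition surr_hess :: "real^'p \<Rightarrow> real^'p \<Rightarrow> real^'p" where
  "surr_hess \<theta> h = cut_l_hess \<theta> h - K *\<^sub>R tail_hess \<theta> h"

text \<open>The sphere of radius \<open>7 \<eta> / 8\<close> around \<open>\<theta>init\<close> may touch the boundary of the ball on which \<open>l\<close>
  is differentiable. On and outside that sphere, differentiability comes from the cutoff vanishing
  to second order while the other factor stays bounded.\<close>

lemma surrogate_has_derivative:
  "(surrogate v \<phi> \<eta> K \<theta>init l has_derivative (\<lambda>h. surr_grad \<theta> \<bullet> h)) (at \<theta>)"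
proof -
  have "((\<lambda>\<theta>. cut (r \<theta>) * (l \<theta> - l \<theta>init)) has_derivative
      (\<lambda>h. ((l \<theta> - l \<theta>init) *\<^sub>R cut_grad \<theta> + cut (r \<theta>) *\<^sub>R gradl \<theta>) \<bullet> h)) (at \<theta>)"
  proof (cases "r \<theta> < 7 * \<eta> / 8")
    case True
    show ?thesis
      by (rule derivative_eq_intros cut_has_derivative l_grad_at ball_init_interior True refl)+
        (simp add: fun_eq_iff inner_add_left algebra_simps)
  next
    case False
    then have z: "cut (r \<theta>) = 0" "cut_grad \<theta> = 0"
      by (auto simp: cut_outer cut_grad_def cut_deriv_zero)
    have "((\<lambda>\<theta>. cut (r \<theta>) * (l \<theta> - l \<theta>init)) has_derivative (\<lambda>h. 0)) (at \<theta>)"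
    proof (rule has_derivative_zero_dominated)
      show "((\<lambda>\<theta>. cut (r \<theta>)) has_derivative (\<lambda>h. 0)) (at \<theta>)"
        using cut_has_derivative[of \<theta>] z by simp
      show "norm (cut (r y) * (l y - l \<theta>init)) \<le> 7 / 8 * (a * \<eta>\<^sup>2 * (2 + P)) * norm (cut (r y))" for y
      proof (cases "r y \<le> 7 * \<eta> / 8")
        case True
        then have "\<bar>l y - l \<theta>init\<bar> * \<bar>cut (r y)\<bar> \<le> 7 / 8 * (a * \<eta>\<^sup>2 * (2 + P)) * \<bar>cut (r y)\<bar>"
          by (intro mult_right_mono l_diff_le) auto
        then show ?thesis by (simp add: abs_mult mult_ac)
      qed (simp add: cut_outer)
    qed (simp add: z)
    then show ?thesis by (simp add: z)
  qed
  from has_derivative_diff[OF has_derivative_add[OF this has_derivative_const[of "l \<theta>init"]]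
      has_derivative_mult_right[OF tail_has_derivative[of \<theta>], of K]]
  show ?thesis
    by (simp add: surrogate_def[abs_def] surr_grad_def cut_def inner_diff_left)
qed

lemma surr_grad_has_derivative: "(surr_grad has_derivative surr_hess \<theta>) (at \<theta>)"
proof -
  have "((\<lambda>\<theta>. (l \<theta> - l \<theta>init) *\<^sub>R cut_grad \<theta> + cut (r \<theta>) *\<^sub>R gradl \<theta>) has_derivative
      cut_l_hess \<theta>) (at \<theta>)"
  proof (cases "r \<theta> < 7 * \<eta> / 8")
    case True
    show ?thesis
      by (rule derivative_eq_intros cut_has_derivative cut_grad_has_derivative l_grad_at l_hess_at
          ball_init_interior True refl)+
        (use True in \<open>simp add: fun_eq_iff cut_l_hess_def algebra_simps\<close>)
  next
    case False
    then have z: "cut (r \<theta>) = 0" "cut_grad \<theta> = 0" "cut' (r \<theta>) = 0" "cut'' (r \<theta>) = 0"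
      by (auto simp: cut_outer cut_grad_def cut_deriv_zero)
    \<comment> \<open>The two summands are treated separately: \<open>cut_grad\<close> is flat here
      because \<open>cut'\<close> and \<open>cut''\<close> vanish, and \<open>cut\<close> is flat
      because \<open>cut_grad\<close> vanishes.\<close>
    have "((\<lambda>\<theta>. (l \<theta> - l \<theta>init) *\<^sub>R cut_grad \<theta>) has_derivative (\<lambda>h. 0)) (at \<theta>)"
    proof (rule has_derivative_zero_dominated)
      have "cut_hess \<theta> = (\<lambda>h. 0)"
        using z by (simp add: cut_hess_def radial_hess_def fun_eq_iff)
      then show "(cut_grad has_derivative (\<lambda>h. 0)) (at \<theta>)"
        using cut_grad_has_derivative[of \<theta>] by simp
      show "norm ((l y - l \<theta>init) *\<^sub>R cut_grad y) \<le> 7 / 8 * (a * \<eta>\<^sup>2 * (2 + P)) * norm (cut_grad y)" for y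
      proof (cases "r y \<le> 7 * \<eta> / 8")
        case True
        then show ?thesis
          unfolding norm_scaleR by (intro mult_right_mono l_diff_le) auto
      qed (simp add: cut_grad_def cut_deriv_zero)
    qed (simp add: z)
    moreover have "((\<lambda>\<theta>. cut (r \<theta>) *\<^sub>R gradl \<theta>) has_derivative (\<lambda>h. 0)) (at \<theta>)"
    proof (rule has_derivative_zero_dominated)
      show "((\<lambda>\<theta>. cut (r \<theta>)) has_derivative (\<lambda>h. 0)) (at \<theta>)"
        using cut_has_derivative[of \<theta>] z by simp
      show "norm (cut (r y) *\<^sub>R gradl y) \<le> a * \<eta> * (2 + P) * norm (cut (r y))" for y
      proof (cases "r y \<le> 7 * \<eta> / 8")
        case True
        then show ?thesis
          unfolding norm_scaleR mult.commute[of "\<bar>cut (r y)\<bar>"] real_norm_def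
          by (intro mult_right_mono gradl_norm_le cball_init_subset) auto
      qed (simp add: cut_outer)
    qed (simp add: z)
    ultimately have "((\<lambda>\<theta>. (l \<theta> - l \<theta>init) *\<^sub>R cut_grad \<theta> + cut (r \<theta>) *\<^sub>R gradl \<theta>) has_derivative
        (\<lambda>h. 0 + 0)) (at \<theta>)"
      by (rule has_derivative_add)
    moreover have "cut_l_hess \<theta> = (\<lambda>h. 0 + 0)"
      using False by (simp add: cut_l_hess_def fun_eq_iff)
    ultimately show ?thesis by simp
  qed
  from has_derivative_diff[OF this has_derivative_scaleR_right[OF tail_grad_has_derivative[of \<theta>], of K]]
  show ?thesis
    by (simp add: surr_grad_def[abs_def] surr_hess_def[abs_def])
qed

section \<open>Size and sign of the Hessian of the surrogate\<close>

lemma cut_grad_norm_le: "norm (cut_grad \<theta>) \<le> N / \<eta>"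
  using cut'_le[of "r \<theta>"] N_ge_1 eta_pos by (cases "\<theta> = \<theta>init") (auto simp: cut_grad_def)

text \<open>Since \<open>cut'\<close> vanishes up to 3\<eta>/4, dividing by the radius costs at most
  4/(3\<eta>); then 11/3 = 1 + 2 * 4/3.\<close>

lemma cut_hess_norm_le: "norm (cut_hess \<theta> h) \<le> 11 / 3 * (N / \<eta>\<^sup>2) * norm h"
proof -
  have "\<bar>cut' (r \<theta>) / r \<theta>\<bar> \<le> 4 / 3 * (N / \<eta>\<^sup>2)"
  proof (cases "r \<theta> \<le> 3 * \<eta> / 4")
    case True
    then show ?thesis using N_ge_1 by (simp add: cut_deriv_zero)
  next
    case False
    then have "\<bar>cut' (r \<theta>) / r \<theta>\<bar> \<le> (N / \<eta>) / (3 * \<eta> / 4)"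
      unfolding abs_divide using eta_pos N_ge_1 cut'_le by (intro frac_le) auto
    then show ?thesis by (simp add: power2_eq_square)
  qed
  with cut''_le[of "r \<theta>"] have "\<bar>cut'' (r \<theta>)\<bar> + 2 * \<bar>cut' (r \<theta>) / r \<theta>\<bar> \<le> 11 / 3 * (N / \<eta>\<^sup>2)"
    by simp
  then show ?thesis
    using radial_hess_norm_le[of cut' cut'' "\<theta> - \<theta>init" h] unfolding cut_hess_def
    by (meson mult_right_mono norm_ge_zero order_trans)
qed

lemma cut_l_hess_norm_le: "norm (cut_l_hess \<theta> h) \<le> 11 * a * N * (1 + P) * norm h"
proof (cases "r \<theta> < 7 * \<eta> / 8")
  case True
  then have B: "\<theta> \<in> cball \<theta>star \<eta>" by (intro cball_init_subset) auto
  have t1: "\<bar>gradl \<theta> \<bullet> h\<bar> * norm (cut_grad \<theta>) \<le> (a * \<eta> * (2 + P) * norm h) * (N / \<eta>)"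
    using a_pos eta_pos P_ge
    by (intro mult_mono abs_inner_le gradl_norm_le[OF B] cut_grad_norm_le) auto
  have t2: "\<bar>l \<theta> - l \<theta>init\<bar> * norm (cut_hess \<theta> h)
      \<le> (7 / 8 * (a * \<eta>\<^sup>2 * (2 + P))) * (11 / 3 * (N / \<eta>\<^sup>2) * norm h)"
    using l_diff_le[of \<theta>] True cut_hess_norm_le[of \<theta> h] a_pos P_ge
    by (intro mult_mono) auto
  have t3: "\<bar>cut_grad \<theta> \<bullet> h\<bar> * norm (gradl \<theta>) \<le> (N / \<eta> * norm h) * (a * \<eta> * (2 + P))"
    using N_ge_1 eta_pos
    by (intro mult_mono abs_inner_le gradl_norm_le[OF B] cut_grad_norm_le) auto
  have t4: "\<bar>cut (r \<theta>)\<bar> * norm (hessl \<theta> *v h) \<le> N * (a * P * norm h)"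
    using v_range N_ge_1 hessl_norm_le[OF B, of h] unfolding cut_def
    by (intro mult_mono) (auto intro: order_trans)
  have tri: "norm (x + y + z + w) \<le> norm x + norm y + norm z + norm w" for x y z w :: "real^'p"
    using norm_triangle_ineq[of "x + y + z" w] norm_triangle_ineq[of "x + y" z] norm_triangle_ineq[of x y]
    by linarith
  have "norm (cut_l_hess \<theta> h) \<le> \<bar>gradl \<theta> \<bullet> h\<bar> * norm (cut_grad \<theta>)
      + \<bar>l \<theta> - l \<theta>init\<bar> * norm (cut_hess \<theta> h) + \<bar>cut_grad \<theta> \<bullet> h\<bar> * norm (gradl \<theta>)
      + \<bar>cut (r \<theta>)\<bar> * norm (hessl \<theta> *v h)"
    unfolding cut_l_hess_def if_P[OF True] norm_scaleR[symmetric] by (rule tri)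
  also have "\<dots> \<le> (a * \<eta> * (2 + P) * norm h) * (N / \<eta>)
      + (7 / 8 * (a * \<eta>\<^sup>2 * (2 + P))) * (11 / 3 * (N / \<eta>\<^sup>2) * norm h)
      + (N / \<eta> * norm h) * (a * \<eta> * (2 + P)) + N * (a * P * norm h)"
    using t1 t2 t3 t4 by linarith
  \<comment> \<open>The cross terms contribute 1 each and the middle term 7/8 * 11/3 = 77/24, in all
    125/24. Doubled by the factor \<open>2 + P\<close> this is 125/12, which is rounded up to
    11.\<close>
  also have "\<dots> = (a * N * norm h) * ((125 / 24) * (2 + P) + P)"
    using eta_pos by (simp add: field_simps)
  also have "\<dots> \<le> (a * N * norm h) * (11 * (1 + P))"
    using a_pos N_ge_1 P_ge by (intro mult_left_mono) auto
  finally show ?thesis by (simp add: mult_ac)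
next
  case False
  then show ?thesis using a_pos N_ge_1 P_ge by (simp add: cut_l_hess_def)
qed

lemma K_pos: "K > 0"
proof -
  have "0 < 60 * a * N * (1 + P)" using a_pos N_ge_1 P_ge by simp
  then show ?thesis using K_ge by linarith
qed

lemma tail_hess_norm_le: "norm (tail_hess \<theta> h) \<le> 6 * norm h"
proof -
  have "\<bar>v_eta' \<eta> (r \<theta>) / r \<theta>\<bar> \<le> 2"
    using v_eta'_le[OF eta_pos, of "r \<theta>"] v_eta'_nonneg[OF eta_pos, of "r \<theta>"]
    by (cases "\<theta> = \<theta>init") (auto simp: field_simps)
  then have "\<bar>v_eta'' \<eta> (r \<theta>)\<bar> + 2 * \<bar>v_eta' \<eta> (r \<theta>) / r \<theta>\<bar> \<le> 6"
    using v_eta''_bounds[of \<eta> "r \<theta>"] by simp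
  then show ?thesis
    using radial_hess_norm_le[of "v_eta' \<eta>" "v_eta'' \<eta>" "\<theta> - \<theta>init" h] unfolding tail_hess_def
    by (meson mult_right_mono norm_ge_zero order_trans)
qed

lemma surr_hess_norm_le: "norm (surr_hess \<theta> h) \<le> 7 * K * norm h"
proof -
  have "norm (surr_hess \<theta> h) \<le> norm (cut_l_hess \<theta> h) + K * norm (tail_hess \<theta> h)"
    unfolding surr_hess_def using norm_triangle_ineq4[of "cut_l_hess \<theta> h" "K *\<^sub>R tail_hess \<theta> h"] K_pos
    by simp
  also have "\<dots> \<le> 11 * a * N * (1 + P) * norm h + K * (6 * norm h)"
    using K_pos by (intro add_mono mult_left_mono cut_l_hess_norm_le tail_hess_norm_le) auto
  also have "\<dots> \<le> 7 * K * norm h"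
  proof -
    have aNP: "0 < a * N * (1 + P)" using a_pos N_ge_1 P_ge by simp
    then have "11 * a * N * (1 + P) \<le> K"
      using K_ge aNP by simp
    then have "11 * a * N * (1 + P) * norm h \<le> K * norm h" by (intro mult_right_mono) auto
    then show ?thesis by simp
  qed
  finally show ?thesis .
qed

lemma surr_hess_quadratic_form_le: "h \<bullet> surr_hess \<theta> h \<le> - m * (norm h)\<^sup>2"
proof (cases "r \<theta> \<le> 3 * \<eta> / 4")
  case True
  then have "r \<theta> < 7 * \<eta> / 8" using eta_pos by simp
  have "0 \<le> h \<bullet> tail_hess \<theta> h"
    using radial_hess_lower[of 0 "v_eta'' \<eta>" "\<theta> - \<theta>init" "v_eta' \<eta>" h]
      v_eta''_bounds v_eta'_nonneg[OF eta_pos] by (simp add: tail_hess_def)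
  then have "0 \<le> K * (h \<bullet> tail_hess \<theta> h)" using K_pos by simp
  moreover have "surr_hess \<theta> h = hessl \<theta> *v h - K *\<^sub>R tail_hess \<theta> h"
    using True \<open>r \<theta> < 7 * \<eta> / 8\<close>
    by (simp add: surr_hess_def cut_l_hess_def cut_grad_def cut_hess_def radial_hess_def
        cut_deriv_zero cut_inner)
  ultimately show ?thesis
    using hessl_quadratic_form_le[OF ball_init_interior[OF \<open>r \<theta> < 7 * \<eta> / 8\<close>], of h]
    by (simp add: inner_diff_right)
next
  case False
  then have "1 / 3 * (norm h)\<^sup>2 \<le> h \<bullet> tail_hess \<theta> h"
    unfolding tail_hess_def using v_eta_far[OF eta_pos, of "r \<theta>"]
    by (intro radial_hess_lower) auto
  then have tail: "K / 3 * (norm h)\<^sup>2 \<le> K * (h \<bullet> tail_hess \<theta> h)"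
    using K_pos mult_left_mono[of "1 / 3 * (norm h)\<^sup>2" _ K] by simp
  have "h \<bullet> cut_l_hess \<theta> h \<le> norm h * norm (cut_l_hess \<theta> h)"
    by (rule norm_cauchy_schwarz)
  also have "\<dots> \<le> norm h * (11 * a * N * (1 + P) * norm h)"
    by (intro mult_left_mono cut_l_hess_norm_le) auto
  finally have cut: "h \<bullet> cut_l_hess \<theta> h \<le> 11 * a * N * (1 + P) * (norm h)\<^sup>2"
    by (simp add: power2_eq_square mult_ac)
  have "m \<le> a * 1 * 1" using m_le by simp
  also have "\<dots> \<le> a * N * (1 + P)"
    using a_pos N_ge_1 P_ge by (intro mult_mono) auto
  \<comment> \<open>The left side is at most 12 units \<open>a * N * (1 + P)\<close>, while
    \<open>K / 3\<close> is at least 20.\<close>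
  finally have "11 * a * N * (1 + P) + m \<le> K / 3"
    using K_ge m_pos by simp
  then have "(11 * a * N * (1 + P) + m) * (norm h)\<^sup>2 \<le> K / 3 * (norm h)\<^sup>2"
    by (intro mult_right_mono) auto
  moreover have "h \<bullet> surr_hess \<theta> h = h \<bullet> cut_l_hess \<theta> h - K * (h \<bullet> tail_hess \<theta> h)"
    by (simp add: surr_hess_def inner_diff_right)
  ultimately show ?thesis
    using tail cut unfolding distrib_right[of _ m] by linarith
qed

text \<open>The distances 3\<eta>/8 and \<eta>/8 add up to \<eta>/2, within which the cutoff is 1
  and the penalty vanishes.\<close>

lemma surrogate_eq:
  assumes "norm (\<theta> - \<theta>star) \<le> 3 * \<eta> / 8"
  shows "surrogate v \<phi> \<eta> K \<theta>init l \<theta> = l \<theta>"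
proof -
  have "r \<theta> \<le> \<eta> / 2"
    using assms init_close norm_triangle_ineq4[of "\<theta> - \<theta>star" "\<theta>init - \<theta>star"] by simp
  then show ?thesis
    using eta_pos cut_inner[of "r \<theta>"] by (simp add: surrogate_def v_eta_zero cut_def)
qed

lemma surrogate_strongly_concave: "strongly_concave m (surrogate v \<phi> \<eta> K \<theta>init l)"
  using surrogate_has_derivative surr_grad_has_derivative surr_hess_quadratic_form_le
  by (rule strongly_concaveI[where G = surr_grad and H = surr_hess])

lemma surrogate_lipschitz_gradient: "lipschitz_gradient (7 * K) (surrogate v \<phi> \<eta> K \<theta>init l)"
  using surrogate_has_derivative surr_grad_has_derivative surr_hess_norm_le
  by (rule lipschitz_gradientI[where G = surr_grad and H = surr_hess])

end

section \<open>The surrogate posterior\<close>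

lemma grad_add:
  fixes f g :: "'a::euclidean_space \<Rightarrow> real"
  assumes "f differentiable (at x)" "g differentiable (at x)"
  shows "grad (\<lambda>x. f x + g x) x = grad f x + grad g x"
  using has_derivative_add[OF assms[THEN has_derivative_grad]]
  by (intro grad_eqI) (simp add: inner_add_left)

lemma grad_add_const:
  fixes f :: "'a::euclidean_space \<Rightarrow> real"
  assumes "f differentiable (at x)"
  shows "grad (\<lambda>x. f x + c) x = grad f x"
  using has_derivative_add[OF has_derivative_grad[OF assms] has_derivative_const[of c]]
  by (intro grad_eqI) simp

lemma strongly_concave_add:
  assumes "strongly_concave m f" "strongly_concave m' g"
  shows "strongly_concave (m + m') (\<lambda>x. f x + g x)"
  unfolding strongly_concave_def
proof safe
  fix x y
  have d: "f differentiable (at x)" "g differentiable (at x)" for x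
    using assms by (auto simp: strongly_concave_def)
  then show "(\<lambda>x. f x + g x) differentiable (at x)" by simp
  have "f y \<le> f x + (y - x) \<bullet> grad f x - m / 2 * (norm (x - y))\<^sup>2"
    "g y \<le> g x + (y - x) \<bullet> grad g x - m' / 2 * (norm (x - y))\<^sup>2"
    using assms by (auto simp: strongly_concave_def)
  then show "f y + g y \<le> f x + g x + (y - x) \<bullet> grad (\<lambda>x. f x + g x) x
      - (m + m') / 2 * (norm (x - y))\<^sup>2"
    by (simp add: grad_add d inner_add_right algebra_simps add_divide_distrib)
qed

lemma lipschitz_gradient_add:
  assumes "lipschitz_gradient L f" "lipschitz_gradient L' g"
  shows "lipschitz_gradient (L + L') (\<lambda>x. f x + g x)"
  unfolding lipschitz_gradient_def
proof safe
  fix x y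
  have d: "f differentiable (at x)" "g differentiable (at x)" for x
    using assms by (auto simp: lipschitz_gradient_def)
  then show "(\<lambda>x. f x + g x) differentiable (at x)" by simp
  have "norm (grad f x - grad f y) \<le> L * norm (x - y)" "norm (grad g x - grad g y) \<le> L' * norm (x - y)"
    using assms by (auto simp: lipschitz_gradient_def)
  then show "norm (grad (\<lambda>x. f x + g x) x - grad (\<lambda>x. f x + g x) y) \<le> (L + L') * norm (x - y)"
    using norm_triangle_ineq[of "grad f x - grad f y" "grad g x - grad g y"]
    by (simp add: grad_add d algebra_simps)
qed

lemma strongly_concave_add_const:
  assumes "strongly_concave m f"
  shows "strongly_concave m (\<lambda>x. f x + c)"
proof -
  have d: "f differentiable (at x)" for x
    using assms by (auto simp: strongly_concave_def)
  show ?thesis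
    using assms d unfolding strongly_concave_def grad_add_const[OF d] by (auto simp: algebra_simps)
qed

lemma lipschitz_gradient_add_const:
  assumes "lipschitz_gradient L f"
  shows "lipschitz_gradient L (\<lambda>x. f x + c)"
proof -
  have d: "f differentiable (at x)" for x
    using assms by (auto simp: lipschitz_gradient_def)
  show ?thesis
    using assms d by (simp add: lipschitz_gradient_def grad_add_const[OF d])
qed

text \<open>Complete the square in \<open>norm y\<close> in the quadratic upper bound expanded at 0.
  This serves to make the normalising integral of the posterior finite.\<close>

lemma strongly_concave_bounded_above:
  fixes f :: "'a::euclidean_space \<Rightarrow> real"
  assumes "strongly_concave m f" "m > 0"
  obtains M where "\<And>y. f y \<le> M"
proof
  fix y
  define g where "g = grad f 0"
  have "f y \<le> f 0 + y \<bullet> g - m / 2 * (norm y)\<^sup>2"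
    using assms(1) by (auto simp: strongly_concave_def g_def dest: spec[of _ 0])
  also have "\<dots> \<le> f 0 + norm y * norm g - m / 2 * (norm y)\<^sup>2"
    using norm_cauchy_schwarz[of y g] by simp
  also have "norm y * norm g - m / 2 * (norm y)\<^sup>2
      = (norm g)\<^sup>2 / (2 * m) - m / 2 * (norm y - norm g / m)\<^sup>2"
    using \<open>m > 0\<close> by (simp add: power2_eq_square field_simps)
  then have "f 0 + norm y * norm g - m / 2 * (norm y)\<^sup>2 \<le> f 0 + (norm g)\<^sup>2 / (2 * m)"
    using \<open>m > 0\<close> by (simp add: add_diff_eq[symmetric])
  finally show "f y \<le> f 0 + (norm (grad f 0))\<^sup>2 / (2 * m)" by (simp add: g_def)
qed

text \<open>A divergent integral would default to 0 and make \<open>post_density\<close> vanish, so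
  integrability and positivity of the normaliser must be shown before \<open>ln\<close> splits. The
  prior times a constant dominates the integrand.\<close>

lemma ln_post_density_eq:
  fixes f \<pi> :: "'a::euclidean_space \<Rightarrow> real"
  assumes f: "strongly_concave m f" "m > 0"
    and \<pi>: "\<And>x. \<pi> x > 0" "integrable lborel \<pi>"
  obtains c where "\<And>x. ln (post_density f \<pi> x) = f x + ln (\<pi> x) + c"
proof -
  obtain M where M: "\<And>y. f y \<le> M"
    using strongly_concave_bounded_above[OF f] by blast
  have "continuous_on UNIV f"
    using f(1) by (auto simp: strongly_concave_def intro!: continuous_at_imp_continuous_on differentiable_imp_continuous_within)
  then have meas: "f \<in> borel_measurable borel" by (rule borel_measurable_continuous_onI)
  have int: "integrable lborel (\<lambda>t. exp (f t) * \<pi> t)"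
  proof (rule Bochner_Integration.integrable_bound)
    show "integrable lborel (\<lambda>t. exp M * \<pi> t)" using \<pi>(2) by simp
    show "(\<lambda>t. exp (f t) * \<pi> t) \<in> borel_measurable lborel"
      using meas borel_measurable_integrable[OF \<pi>(2)] by measurable
    show "AE t in lborel. norm (exp (f t) * \<pi> t) \<le> norm (exp M * \<pi> t)"
      using M \<pi>(1) by (auto simp: abs_mult intro!: mult_right_mono)
  qed
  have pos: "exp (f t) * \<pi> t > 0" for t using \<pi>(1) by simp
  define Z where "Z = (\<integral>t. exp (f t) * \<pi> t \<partial>lborel)"
  \<comment> \<open>A nonnegative integrand with integral 0 vanishes almost everywhere, whereas this
    one is positive at every point.\<close>
  have "Z \<noteq> 0"
  proof
    assume "Z = 0"
    then have "AE t in lborel. exp (f t) * \<pi> t = 0"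
      using integral_nonneg_eq_0_iff_AE[OF int] pos by (simp add: Z_def less_imp_le)
    then have "AE t::'a in lborel. False"
      by (rule AE_mp) (use pos in \<open>auto intro!: AE_I2 simp: less_le\<close>)
    then show False
      by (simp add: AE_iff_null emeasure_lborel_UNIV null_sets_def)
  qed
  moreover have "Z \<ge> 0"
    unfolding Z_def using pos by (intro Bochner_Integration.integral_nonneg) (simp add: less_imp_le)
  ultimately have "Z > 0" by simp
  show thesis
  proof
    fix x
    show "ln (post_density f \<pi> x) = f x + ln (\<pi> x) + - ln Z"
      using \<open>Z > 0\<close> \<pi>(1)[of x] by (simp add: post_density_def Z_def[symmetric] ln_div ln_mult)
  qed
qed

theorem theorem3p2:
  fixes n :: nat
    and dens :: "real^'p \<Rightarrow> 'z \<Rightarrow> real" and Z :: "nat \<Rightarrow> 'z"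
    and \<pi> :: "real^'p \<Rightarrow> real" and m\<pi> \<Lambda>\<pi> :: real and \<theta>\<pi>max :: "real^'p"
    and c0 \<delta> \<beta> :: real and \<theta>star :: "real^'p"
    and \<eta> cmax cmin \<kappa>1 \<kappa>2 \<kappa>3 :: real
    and gradl :: "real^'p \<Rightarrow> real^'p" and hessl :: "real^'p \<Rightarrow> real^'p^'p"
    and C K :: real and \<theta>init :: "real^'p"
    and v \<phi> :: "real \<Rightarrow> real"
  defines "l \<equiv> loglik dens Z n"
    and "p \<equiv> CARD('p)"
    and "B \<equiv> cball \<theta>star \<eta>"
  assumes n_large: "n \<ge> 2"
    (* Assumption (A): the parts relevant for a fixed n *)
    and c0_pos: "c0 > 0" and theta_star_bound: "norm \<theta>star \<le> c0"
    and delta_pos: "\<delta> > 0" and beta_ge: "\<beta> \<ge> 1"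
    (* Assumption (B) *)
    and pi_pos: "\<forall>\<theta>. \<pi> \<theta> > 0"
    and pi_density: "integrable lborel \<pi>" "(\<integral>\<theta>. \<pi> \<theta> \<partial>lborel) = 1"
    and m_pi_pos: "m\<pi> > 0"
    and pi_concave: "strongly_concave m\<pi> (\<lambda>\<theta>. ln (\<pi> \<theta>))"
    and pi_lipschitz: "lipschitz_gradient \<Lambda>\<pi> (\<lambda>\<theta>. ln (\<pi> \<theta>))"
    and pi_max: "\<forall>\<theta>. \<pi> \<theta> \<le> \<pi> \<theta>\<pi>max" and pi_max_bound: "norm \<theta>\<pi>max \<le> c0"
    (* Assumption (C), on the event E, for the realisation Z *)
    and eta_pos: "0 < \<eta>" and eta_le1: "\<eta> \<le> 1"
    and l_grad: "\<forall>\<theta>\<in>B. (l has_derivative (\<lambda>h. gradl \<theta> \<bullet> h)) (at \<theta> within B)"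
    and l_hess: "\<forall>\<theta>\<in>B. (gradl has_derivative (\<lambda>h. hessl \<theta> *v h)) (at \<theta> within B)"
    and l_hess_cont: "continuous_on B hessl"
    and cmin_pos: "cmin > 0" and cmin_le_cmax: "cmin \<le> cmax"
    and kappa_nonneg: "\<kappa>1 \<ge> 0" "\<kappa>2 \<ge> 0" "\<kappa>3 \<ge> 0"
    and E_grad: "norm (gradl \<theta>star) \<le> cmax * n * \<delta> * real p powr \<kappa>1"
    and E_hess_upper: "\<forall>\<theta>\<in>B. op_norm (hessl \<theta>) \<le> cmax * n * real p powr \<kappa>2"
    and E_hess_lower: "\<forall>\<theta>\<in>B. lambda_min (- hessl \<theta>) \<ge> cmin * n * real p powr (- \<kappa>3)"
    (* the fixed auxiliary functions v and phi *)
    and v_smooth: "smooth_real v" and v_range: "\<forall>t. 0 \<le> v t \<and> v t \<le> 1"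
    and v_one: "\<forall>t. t \<le> 3/4 \<longrightarrow> v t = 1" and v_zero: "\<forall>t. t > 7/8 \<longrightarrow> v t = 0"
    and phi_smooth: "smooth_real \<phi>" and phi_nonneg: "\<forall>x. \<phi> x \<ge> 0"
    and phi_even: "\<forall>x. \<phi> (- x) = \<phi> x" and phi_supp: "\<forall>x. \<bar>x\<bar> > 1 \<longrightarrow> \<phi> x = 0"
    and phi_int: "integrable lborel \<phi>" "(\<integral>x. \<phi> x \<partial>lborel) = 1"
    (* Assumption (D) *)
    and K_pos: "K > 0"
    and init_close: "norm (\<theta>init - \<theta>star) \<le> \<eta> / 8"
    and C_pos: "C > 0" and p_bound: "real p \<le> C * n * \<delta>\<^sup>2"
    and eta_bound: "\<eta> \<ge> ln (real n) * max (\<delta> powr (1 / \<beta>)) (\<delta> * real p powr (\<kappa>1 + \<kappa>3))"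
    and K_bound: "K \<ge> 60 * cmax * C2_norm v * n * (1 + real p powr \<kappa>2)"
  shows "(\<forall>\<theta>. norm (\<theta> - \<theta>star) \<le> 3 * \<eta> / 8 \<longrightarrow> l \<theta> = surrogate v \<phi> \<eta> K \<theta>init l \<theta>)
       \<and> strongly_concave (cmin * n * real p powr (- \<kappa>3)) (surrogate v \<phi> \<eta> K \<theta>init l)
       \<and> lipschitz_gradient (7 * K) (surrogate v \<phi> \<eta> K \<theta>init l)
       \<and> strongly_concave (cmin * n * real p powr (- \<kappa>3) + m\<pi>)
           (\<lambda>\<theta>. ln (post_density (surrogate v \<phi> \<eta> K \<theta>init l) \<pi> \<theta>))
       \<and> lipschitz_gradient (7 * K + \<Lambda>\<pi>)
           (\<lambda>\<theta>. ln (post_density (surrogate v \<phi> \<eta> K \<theta>init l) \<pi> \<theta>))"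
proof -
  define a where "a = cmax * real n"
  define P where "P = real p powr \<kappa>2"
  define m where "m = cmin * real n * real p powr (- \<kappa>3)"
  have p1: "real p \<ge> 1" unfolding p_def by (simp add: Suc_leI)
  have n0: "real n > 0" and cmax0: "cmax > 0"
    using n_large cmin_pos cmin_le_cmax by auto
  have "1 / 2 \<le> ln (real 2)" using ln2_ge_two_thirds by simp
  also have "\<dots> \<le> ln (real n)" using n_large by (intro ln_mono) auto
  finally have ln_n: "1 / 2 \<le> ln (real n)" .
  \<comment> \<open>As p is at least 1, adding \<kappa>3 to the exponent only enlarges the power;
    the bound on \<eta> then applies.\<close>
  have "\<delta> * real p powr \<kappa>1 \<le> \<delta> * real p powr (\<kappa>1 + \<kappa>3)"
    using p1 delta_pos kappa_nonneg by (intro mult_left_mono powr_mono) auto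
  also have "\<dots> \<le> max (\<delta> powr (1 / \<beta>)) (\<delta> * real p powr (\<kappa>1 + \<kappa>3))" (is "_ \<le> ?M") by simp
  finally have M: "\<delta> * real p powr \<kappa>1 \<le> ?M" .
  have "1 / 2 * ?M \<le> ln (real n) * ?M"
    using ln_n by (intro mult_right_mono) (auto simp: le_max_iff_disj)
  with M eta_bound have delta: "\<delta> * real p powr \<kappa>1 \<le> 2 * \<eta>" by linarith
  have "norm (gradl \<theta>star) \<le> a * (\<delta> * real p powr \<kappa>1)"
    using E_grad by (simp add: a_def mult.assoc)
  also have "\<dots> \<le> a * (2 * \<eta>)"
    using delta n0 cmax0 by (intro mult_left_mono) (auto simp: a_def)
  finally have grad_star: "norm (gradl \<theta>star) \<le> 2 * a * \<eta>" by simp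
  \<comment> \<open>Yields \<open>m \<le> a\<close>, by which \<open>K\<close> can absorb the
    required concavity far from \<open>\<theta>init\<close>.\<close>
  have "real p powr (- \<kappa>3) \<le> real p powr 0"
    using p1 kappa_nonneg by (intro powr_mono) auto
  then have "real p powr (- \<kappa>3) \<le> 1" using p1 by simp
  then have "cmin * real n * real p powr (- \<kappa>3) \<le> cmax * real n * 1"
    using n0 cmin_pos cmin_le_cmax by (intro mult_mono) auto
  then have m_le: "m \<le> a" by (simp add: m_def a_def)
  interpret local_surrogate \<phi> l gradl hessl \<theta>star \<theta>init \<eta> a P m K v
  proof
    show "continuous_on UNIV \<phi>"
      using smooth_real_continuous[OF phi_smooth, of UNIV 0] by simp
    show "0 < m" using p1 n0 cmin_pos by (simp add: m_def)
    show "1 \<le> P" using p1 kappa_nonneg by (simp add: P_def ge_one_powr_ge_zero)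
    show "60 * a * C2_norm v * (1 + P) \<le> K"
      using K_bound by (simp add: a_def P_def mult_ac)
    show "op_norm (hessl \<theta>) \<le> a * P" if "\<theta> \<in> cball \<theta>star \<eta>" for \<theta>
      using E_hess_upper that by (simp add: a_def P_def B_def)
    show "m \<le> lambda_min (- hessl \<theta>)" if "\<theta> \<in> cball \<theta>star \<eta>" for \<theta>
      using E_hess_lower that by (simp add: m_def B_def)
    show "(l has_derivative (\<lambda>h. gradl \<theta> \<bullet> h)) (at \<theta> within cball \<theta>star \<eta>)"
      if "\<theta> \<in> cball \<theta>star \<eta>" for \<theta>
      using l_grad that unfolding B_def by blast
    show "(gradl has_derivative (\<lambda>h. hessl \<theta> *v h)) (at \<theta> within cball \<theta>star \<eta>)"
      if "\<theta> \<in> cball \<theta>star \<eta>" for \<theta>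
      using l_hess that unfolding B_def by blast
  qed (use phi_nonneg phi_even phi_supp phi_int eta_pos grad_star init_close m_le
      v_smooth v_range v_one v_zero in auto)
  let ?S = "surrogate v \<phi> \<eta> K \<theta>init l"
  obtain c where c: "\<And>\<theta>. ln (post_density ?S \<pi> \<theta>) = ?S \<theta> + ln (\<pi> \<theta>) + c"
    using ln_post_density_eq[OF surrogate_strongly_concave m_pos, of \<pi>] pi_pos pi_density(1) by blast
  have "strongly_concave (m + m\<pi>) (\<lambda>\<theta>. ln (post_density ?S \<pi> \<theta>))"
    unfolding c by (intro strongly_concave_add_const strongly_concave_add
        surrogate_strongly_concave pi_concave)
  moreover have "lipschitz_gradient (7 * K + \<Lambda>\<pi>) (\<lambda>\<theta>. ln (post_density ?S \<pi> \<theta>))"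
    unfolding c by (intro lipschitz_gradient_add_const lipschitz_gradient_add
        surrogate_lipschitz_gradient pi_lipschitz)
  ultimately show ?thesis
    using surrogate_eq surrogate_strongly_concave surrogate_lipschitz_gradient
    unfolding m_def by simp
qed

end
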